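(* Let $N\ge 2$, let $\Omega\subset\mathbb{R}^N$ be a smooth bounded domain, and let $q\in(1,1^* )$, where $1^*=N/(N-1)$. For $\lambda,a>0$ let $I_{\lambda,a}:L^q(\Omega)\to(-\infty,\infty]$ be the energy functional and $(P_{\lambda,a})$ the boundary value problem defined in the context. There exists $\lambda_0>0$ such that for every $\lambda\in(0,\lambda_0)$ and every $a>0$ the functional $I_{\lambda,a}$ has a sequence of critical points $\big(u^{(n)}_{\lambda,a}\big)_{n\in\mathbb{N}}$; consequently, problem $(P_{\lambda,a})$ has infinitely many solutions for $\lambda\in(0,\lambda_0)$. Moreover, for $\lambda\in(0,\lambda_0)$ there exists $a_0>0$ small enough (independent of $n$) such that for every $a\in(0,a_0)$ each solution $u^{(n)}_{\lambda,a}$, $n\in\mathbb{N}$, satisfies $$\big|\{x\in\Omega:\ |u^{(n)}_{\lambda,a}(x)|>a\}\big|>0 .$$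
   Context: $|A|$ denotes Lebesgue measure. $BV(\Omega)$ is the space of functions of bounded variation, normed by $\|u\|_{BV(\Omega)}=\int_\Omega|Du|+\int_{\partial\Omega}|u|\,d\mathcal{H}^{N-1}$ (the boundary integral uses the trace of $u$). Problem $(P_{\lambda,a})$: $-\Delta_1 u=\lambda\,\mathrm{sign}(u)+H(|u|-a)|u|^{q-2}u$ in $\Omega$, $u=0$ on $\partial\Omega$, where $\mathrm{sign}(s)=s/|s|$ for $s\ne0$, $\mathrm{sign}(0)=0$, and $H(t)=0$ for $t<0$, $H(t)=1$ for $t\ge0$. Put $F(s)=\int_0^s\mathrm{sign}(t)\,dt=|s|$ and $G_a(s)=\int_0^sH(|t|-a)|t|^{q-2}t\,dt$. Their generalized gradients are: $\partial F(s)=\{\mathrm{sign}(s)\}$ for $s\neq0$, $\partial F(0)=[-1,1]$; $\partial G_a(s)=\{|s|^{q-2}s\}$ if $|s|>a$, $\{0\}$ if $|s|<a$, $[0,a^{q-1}]$ if $s=a$, $[-a^{q-1},0]$ if $s=-a$. A solution of $(P_{\lambda,a})$ is a function $u\in BV(\Omega)$ for which there exists $\mathbf z\in L^\infty(\Omega,\mathbb{R}^N)$ with $\|\mathbf z\|_\infty\le1$ such that $-\int_\Omega u\,\mathrm{div}\,\mathbf z\,dx=\int_\Omega|Du|+\int_{\partial\Omega}|u|\,d\mathcal{H}^{N-1}$ and $-\mathrm{div}\,\mathbf z=\lambda\rho_1+\rho_2$ a.e. in $\Omega$, with $\rho_1(x)\in\partial F(u(x))$ and $\rho_2(x)\in\partial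 G_a(u(x))$ for a.e. $x\in\Omega$. Energy functional: $I_{\lambda,a}=\Phi_{\lambda,a}+\Psi$ on $L^q(\Omega)$, where $\Phi_{\lambda,a}(u)=-\lambda\int_\Omega F(u)\,dx-\int_\Omega G_a(u)\,dx$ (locally Lipschitz), and $\Psi(u)=\int_\Omega|Du|+\int_{\partial\Omega}|u|\,d\mathcal{H}^{N-1}$ if $u\in BV(\Omega)$, $\Psi(u)=+\infty$ if $u\in L^q(\Omega)\setminus BV(\Omega)$ (convex, lower semicontinuous). A critical point of $I=\Phi+\Psi:X\to(-\infty,\infty]$ ($\Phi$ locally Lipschitz, $\Psi$ convex, l.s.c., proper, $X$ Banach) is a point $u$ with $I(u)<\infty$ and $\Phi^\circ(u;v-u)+\Psi(v)-\Psi(u)\ge0$ for all $v\in X$, where $\Phi^\circ(u;v)=\limsup_{w\to u,\,t\to0^+}\frac{\Phi(w+tv)-\Phi(w)}{t}$. *)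

theory Defs
  imports "HOL-Analysis.Analysis"
begin

section \<open>Smooth functions, test functions and smooth bounded domains\<close>

text \<open>\<open>C_k k f\<close>: all partial derivatives of \<open>f\<close> of order at most \<open>k\<close> exist and are
  continuous on the whole space.\<close>

primrec C_k :: "nat \<Rightarrow> ('a::euclidean_space \<Rightarrow> 'b::real_normed_vector) \<Rightarrow> bool" where
  "C_k 0 f \<longleftrightarrow> continuous_on UNIV f"
| "C_k (Suc k) f \<longleftrightarrow>
     (\<exists>f'. (\<forall>x. (f has_derivative f' x) (at x)) \<and> (\<forall>i\<in>Basis. C_k k (\<lambda>x. f' x i)))"

definition C_infinity :: "('a::euclidean_space \<Rightarrow> 'b::real_normed_vector) \<Rightarrow> bool" where
  "C_infinity f \<longleftrightarrow> (\<forall>k. C_k k f)"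

definition compactly_supported_in :: "'a::euclidean_space set \<Rightarrow> ('a \<Rightarrow> 'b::real_normed_vector) \<Rightarrow> bool" where
  "compactly_supported_in \<Omega> f \<longleftrightarrow>
     compact (closure {x. f x \<noteq> 0}) \<and> closure {x. f x \<noteq> 0} \<subseteq> \<Omega>"

text \<open>Near each boundary point, after a rotation of the axes, the domain lies strictly above the
  graph of a smooth function.  The unit vector \<open>e\<close> is the vertical direction, and \<open>\<gamma>\<close> is only
  evaluated at projections to the hyperplane orthogonal to \<open>e\<close>, so it is in effect a smooth
  function of \<open>N - 1\<close> variables.\<close>

definition smooth_bounded_domain :: "'a::euclidean_space set \<Rightarrow> bool" where
  "smooth_bounded_domain \<Omega> \<longleftrightarrow>
     open \<Omega> \<and> connected \<Omega> \<and> \<Omega> \<noteq> {} \<and> bounded \<Omega> \<and>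
     (\<forall>p\<in>frontier \<Omega>. \<exists>r>0. \<exists>e. \<exists>\<gamma>::'a \<Rightarrow> real. norm e = 1 \<and> C_infinity \<gamma> \<and>
        \<Omega> \<inter> ball p r = {x \<in> ball p r. x \<bullet> e > \<gamma> (x - (x \<bullet> e) *\<^sub>R e)})"

section \<open>Functions of bounded variation\<close>

definition divergence :: "('a::euclidean_space \<Rightarrow> 'a) \<Rightarrow> 'a \<Rightarrow> real" where
  "divergence \<phi> x = (\<Sum>i\<in>Basis. frechet_derivative \<phi> (at x) i \<bullet> i)"

definition total_variation :: "'a::euclidean_space set \<Rightarrow> ('a \<Rightarrow> real) \<Rightarrow> ereal" where
  "total_variation \<Omega> u =
     (SUP \<phi>\<in>{\<phi> :: 'a \<Rightarrow> 'a. C_k 1 \<phi> \<and> compactly_supported_in \<Omega> \<phi> \<and> (\<forall>x. norm (\<phi> x) \<le> 1)}.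
        ereal (\<integral>x. u x * divergence \<phi> x \<partial>lebesgue_on \<Omega>))"

definition BV :: "'a::euclidean_space set \<Rightarrow> ('a \<Rightarrow> real) set" where
  "BV \<Omega> = {u. integrable (lebesgue_on \<Omega>) u \<and> total_variation \<Omega> u < \<infinity>}"

text \<open>The \<open>s\<close>-dimensional Hausdorff outer measure (\<open>s \<ge> 1\<close>), normalised so that it agrees with
  surface area.  Coverings use bounded sets because \<open>diameter\<close> is unspecified on unbounded ones.
  It is a metric outer measure, hence countably additive on Borel sets, so \<open>measure_of\<close> below
  does not collapse to the zero measure.\<close>

definition hausdorff_outer :: "nat \<Rightarrow> 'a::metric_space set \<Rightarrow> ennreal" where
  "hausdorff_outer s A =
     (SUP \<delta>\<in>{0<..}.
        INF C\<in>{C :: nat \<Rightarrow> 'a set. A \<subseteq> (\<Union>i. C i) \<and> (\<forall>i. bounded (C i) \<and> diameter (C i) \<le> \<delta>)}.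
          \<Sum>i. ennreal (unit_ball_vol (real s) * (diameter (C i) / 2) ^ s))"

definition hausdorff_measure :: "nat \<Rightarrow> 'a::metric_space measure" where
  "hausdorff_measure s = measure_of UNIV (sets borel) (hausdorff_outer s)"

text \<open>The boundary trace: for \<open>u\<close> in \<open>BV \<Omega>\<close> the limit condition determines a unique value at
  almost every boundary point with respect to \<open>(N - 1)\<close>-dimensional Hausdorff measure;
  at the remaining points the value is irrelevant.\<close>

definition bv_trace :: "'a::euclidean_space set \<Rightarrow> ('a \<Rightarrow> real) \<Rightarrow> 'a \<Rightarrow> real" where
  "bv_trace \<Omega> u x =
     (THE c. ((\<lambda>r. (\<integral>y. \<bar>u y - c\<bar> \<partial>lebesgue_on (\<Omega> \<inter> ball x r)) / r ^ DIM('a)) \<longlongrightarrow> 0) (at_right 0))"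

definition BV_norm :: "'a::euclidean_space set \<Rightarrow> ('a \<Rightarrow> real) \<Rightarrow> ereal" where
  "BV_norm \<Omega> u =
     total_variation \<Omega> u +
     enn2ereal (\<integral>\<^sup>+x\<in>frontier \<Omega>. ennreal \<bar>bv_trace \<Omega> u x\<bar> \<partial>hausdorff_measure (DIM('a) - 1))"

section \<open>The boundary value problem\<close>

definition heaviside :: "real \<Rightarrow> real" where
  "heaviside t = (if t < 0 then 0 else 1)"

definition F :: "real \<Rightarrow> real" where
  "F s = (LBINT t=0..s. sgn t)"

definition G :: "real \<Rightarrow> real \<Rightarrow> real \<Rightarrow> real" where
  "G q a s = (LBINT t=0..s. heaviside (\<bar>t\<bar> - a) * (\<bar>t\<bar> powr (q - 2) * t))"

definition grad_F :: "real \<Rightarrow> real set" where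
  "grad_F s = (if s = 0 then {-1..1} else {sgn s})"

definition grad_G :: "real \<Rightarrow> real \<Rightarrow> real \<Rightarrow> real set" where
  "grad_G q a s =
     (if \<bar>s\<bar> > a then {\<bar>s\<bar> powr (q - 2) * s}
      else if \<bar>s\<bar> < a then {0}
      else if s = a then {0..a powr (q - 1)}
      else {- (a powr (q - 1))..0})"

text \<open>The distributional divergence of \<open>z\<close> in \<open>\<Omega>\<close> is the locally integrable function \<open>d\<close>.
  Here \<open>frechet_derivative \<phi> (at x) (z x)\<close> is the inner product of \<open>z x\<close> with the gradient of
  \<open>\<phi>\<close> at \<open>x\<close>.\<close>

definition has_weak_divergence :: "'a::euclidean_space set \<Rightarrow> ('a \<Rightarrow> 'a) \<Rightarrow> ('a \<Rightarrow> real) \<Rightarrow> bool" where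
  "has_weak_divergence \<Omega> z d \<longleftrightarrow>
     (\<forall>K. compact K \<and> K \<subseteq> \<Omega> \<longrightarrow> integrable (lebesgue_on K) d) \<and>
     (\<forall>\<phi>::'a \<Rightarrow> real. C_infinity \<phi> \<and> compactly_supported_in \<Omega> \<phi> \<longrightarrow>
        (\<integral>x. frechet_derivative \<phi> (at x) (z x) \<partial>lebesgue_on \<Omega>) =
        - (\<integral>x. d x * \<phi> x \<partial>lebesgue_on \<Omega>))"

definition is_solution ::
  "'a::euclidean_space set \<Rightarrow> real \<Rightarrow> real \<Rightarrow> real \<Rightarrow> ('a \<Rightarrow> real) \<Rightarrow> bool" where
  "is_solution \<Omega> q lam a u \<longleftrightarrow>
     u \<in> BV \<Omega> \<and>
     (\<exists>(z :: 'a \<Rightarrow> 'a) div_z \<rho>1 \<rho>2.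
        z \<in> borel_measurable (lebesgue_on \<Omega>) \<and> (AE x in lebesgue_on \<Omega>. norm (z x) \<le> 1) \<and>
        has_weak_divergence \<Omega> z div_z \<and>
        integrable (lebesgue_on \<Omega>) (\<lambda>x. u x * div_z x) \<and>
        ereal (- (\<integral>x. u x * div_z x \<partial>lebesgue_on \<Omega>)) = BV_norm \<Omega> u \<and>
        \<rho>1 \<in> borel_measurable (lebesgue_on \<Omega>) \<and> \<rho>2 \<in> borel_measurable (lebesgue_on \<Omega>) \<and>
        (AE x in lebesgue_on \<Omega>. - div_z x = lam * \<rho>1 x + \<rho>2 x) \<and>
        (AE x in lebesgue_on \<Omega>. \<rho>1 x \<in> grad_F (u x)) \<and>
        (AE x in lebesgue_on \<Omega>. \<rho>2 x \<in> grad_G q a (u x)))"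

section \<open>The energy functional and its critical points\<close>

text \<open>Elements of \<open>L\<^sup>q(\<Omega>)\<close> are represented by functions on the whole space whose values outside
  \<open>\<Omega>\<close> are ignored; equality in \<open>L\<^sup>q(\<Omega>)\<close> is equality almost everywhere on \<open>\<Omega>\<close>.\<close>

definition Lq :: "'a::euclidean_space set \<Rightarrow> real \<Rightarrow> ('a \<Rightarrow> real) set" where
  "Lq \<Omega> q = {u \<in> borel_measurable (lebesgue_on \<Omega>).
     integrable (lebesgue_on \<Omega>) (\<lambda>x. \<bar>u x\<bar> powr q)}"

definition Lq_norm :: "'a::euclidean_space set \<Rightarrow> real \<Rightarrow> ('a \<Rightarrow> real) \<Rightarrow> real" where
  "Lq_norm \<Omega> q u = (\<integral>x. \<bar>u x\<bar> powr q \<partial>lebesgue_on \<Omega>) powr (1 / q)"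

definition ae_eq :: "'a::euclidean_space set \<Rightarrow> (('a \<Rightarrow> real) \<times> ('a \<Rightarrow> real)) set" where
  "ae_eq \<Omega> = {(u, v). AE x in lebesgue_on \<Omega>. u x = v x}"

definition \<Phi> :: "'a::euclidean_space set \<Rightarrow> real \<Rightarrow> real \<Rightarrow> real \<Rightarrow> ('a \<Rightarrow> real) \<Rightarrow> real" where
  "\<Phi> \<Omega> q lam a u =
     - lam * (\<integral>x. F (u x) \<partial>lebesgue_on \<Omega>) - (\<integral>x. G q a (u x) \<partial>lebesgue_on \<Omega>)"

definition \<Psi> :: "'a::euclidean_space set \<Rightarrow> ('a \<Rightarrow> real) \<Rightarrow> ereal" where
  "\<Psi> \<Omega> u = (if u \<in> BV \<Omega> then BV_norm \<Omega> u else \<infinity>)"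

text \<open>The generalized directional derivative and critical points of \<open>f + g\<close> on a space \<open>X\<close> of
  real functions with (semi)norm \<open>nrm\<close>.  The filter describes \<open>w \<rightarrow> u\<close> within \<open>X\<close> in the sense
  of \<open>nrm\<close>, together with \<open>t \<rightarrow> 0+\<close>; the point \<open>w = u\<close> is allowed.\<close>

definition clarke_derivative ::
  "('a \<Rightarrow> real) set \<Rightarrow> (('a \<Rightarrow> real) \<Rightarrow> real) \<Rightarrow> (('a \<Rightarrow> real) \<Rightarrow> real) \<Rightarrow>
     ('a \<Rightarrow> real) \<Rightarrow> ('a \<Rightarrow> real) \<Rightarrow> ereal" where
  "clarke_derivative X nrm f u v =
     Limsup (inf (principal X) (filtercomap (\<lambda>w. nrm (\<lambda>x. w x - u x)) (nhds 0)) \<times>\<^sub>F at_right 0)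
       (\<lambda>(w, t). ereal ((f (\<lambda>x. w x + t * v x) - f w) / t))"

definition critical_point ::
  "('a \<Rightarrow> real) set \<Rightarrow> (('a \<Rightarrow> real) \<Rightarrow> real) \<Rightarrow> (('a \<Rightarrow> real) \<Rightarrow> real) \<Rightarrow> (('a \<Rightarrow> real) \<Rightarrow> ereal) \<Rightarrow>
     ('a \<Rightarrow> real) \<Rightarrow> bool" where
  "critical_point X nrm f g u \<longleftrightarrow>
     u \<in> X \<and> ereal (f u) + g u < \<infinity> \<and>
     (\<forall>v\<in>X. clarke_derivative X nrm f u (\<lambda>x. v x - u x) + g v - g u \<ge> 0)"

definition is_critical_point ::
  "'a::euclidean_space set \<Rightarrow> real \<Rightarrow> real \<Rightarrow> real \<Rightarrow> ('a \<Rightarrow> real) \<Rightarrow> bool" where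
  "is_critical_point \<Omega> q lam a u \<longleftrightarrow>
     critical_point (Lq \<Omega> q) (Lq_norm \<Omega> q) (\<Phi> \<Omega> q lam a) (\<Psi> \<Omega>) u"

end

theory Submission
  imports Defs
begin

text \<open>Multiples of indicators of small balls are explicit solutions.  Let \<open>u = c\<close> on a ball of radius
  \<open>r\<close> and \<open>u = 0\<close> elsewhere, with \<open>lam + c\<^sup>q\<^sup>-\<^sup>1 = N / r\<close>; then \<open>c > a\<close> once \<open>r\<close> is small.  The field
  \<open>z(x) = - x / r\<close> has \<open>- div z = N / r\<close> in the ball, and outside it continues radially with
  \<open>div z = lam\<close> (that is, \<open>\<rho>1 = - 1\<close>, which is allowed because \<open>u = 0\<close> there) until it vanishes on a sphere
  of radius \<open>R\<close>, where \<open>R \<rightarrow> 0\<close> as \<open>r \<rightarrow> 0\<close>.  Hence \<open>z\<close> is compactly supported in \<open>\<Omega>\<close>, and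
  \<open>- \<integral> v div z\<close> is at most the total variation of \<open>v\<close> for all \<open>v\<close>, with equality for \<open>v = u\<close>.
  Criticality follows from this calibration because \<open>F\<close> and \<open>G\<close> are convex: the Clarke derivative of
  \<open>\<Phi>\<close> at \<open>u\<close> in direction \<open>h\<close> is at least \<open>\<integral> h div z\<close>.\<close>

section \<open>Integration by parts for compactly supported fields\<close>

text \<open>Equality in the calibration forces -z to be the unit outer normal on the sphere where u
  jumps. On a ball, x / r (x measured from the centre) extends this normal inwards with constant
  divergence, so that one value c solves the equation on the whole ball. Three obstacles shape the
  proof. The field has kinks on the spheres of radius r and R, whereas the total variation is a
  supremum over C^1 fields; it is therefore approximated by C^1 fields with the same norm bound and
  support. The perimeter of a ball needs an upper bound without surface integrals; an arbitrary test
  field is compared with x / r along smooth cutoffs. The trace is a definite description, so even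
  for a function vanishing near the boundary its value is known only once uniqueness is proved, and
  this uses the regularity of the domain. The boundary term then vanishes for u, and for competitors
  it is only bounded below by 0.\<close>

lemma integrable_indicator_cball:
  fixes p :: "'a::euclidean_space"
  shows "integrable lebesgue (\<lambda>x. M * indicat_real (cball p B) x)"
  using emeasure_bounded_finite[OF bounded_cball, of p B]
  by (intro integrable_mult_right integrable_real_indicator) auto

lemma integrable_bounded_support:
  fixes f :: "'a::euclidean_space \<Rightarrow> real"
  assumes "f \<in> borel_measurable lebesgue" and "AE x in lebesgue. \<bar>f x\<bar> \<le> M * indicator (cball p B) x"
  shows "integrable lebesgue f"
  using assms
  by (intro Bochner_Integration.integrable_bound[OF integrable_indicator_cball[of M p B]])
     (auto elim!: eventually_mono)

lemma lebesgue_measurable_continuous: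
  fixes f :: "'a::euclidean_space \<Rightarrow> 'b::euclidean_space"
  assumes "continuous_on UNIV f"
  shows "f \<in> borel_measurable lebesgue"
  using borel_measurable_continuous_onI[OF assms] by (simp add: measurable_completion)

lemma has_derivative_zero_outside:
  fixes f :: "'a::real_normed_vector \<Rightarrow> 'b::real_normed_vector"
  assumes "(f has_derivative f') (at x)" and "closed K" "x \<notin> K" and "\<And>y. y \<notin> K \<Longrightarrow> f y = 0"
  shows "f' = (\<lambda>_. 0)"
proof -
  have "(f has_derivative (\<lambda>_. 0)) (at x)"
    by (rule has_derivative_transform_within_open[where f = "\<lambda>_. 0" and s = "- K"])
       (use assms in \<open>auto simp: open_Compl\<close>)
  then show ?thesis
    using assms(1) has_derivative_unique by blast
qed

lemma continuous_compact_support_bounded: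
  fixes f :: "'a::euclidean_space \<Rightarrow> 'b::real_normed_vector"
  assumes "continuous_on UNIV f" and "\<And>x. x \<notin> cball p B \<Longrightarrow> f x = 0"
  obtains M where "M \<ge> 0" "\<And>x. norm (f x) \<le> M"
proof -
  have "bounded (f ` cball p B)"
    by (intro compact_imp_bounded compact_continuous_image) (auto intro: continuous_on_subset assms)
  then obtain M where "M > 0" "\<And>x. x \<in> cball p B \<Longrightarrow> norm (f x) \<le> M"
    by (auto simp: bounded_pos)
  then show ?thesis
    using assms(2) by (intro that[of M]) (auto simp: less_imp_le, metis less_imp_le norm_zero)
qed

lemma integral_translate:
  fixes f :: "'a::euclidean_space \<Rightarrow> real"
  assumes "f \<in> borel_measurable borel"
  shows "(\<integral>x. f (c + x) \<partial>lborel) = integral\<^sup>L lborel f"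
  by (subst (2) lborel_distr_plus[of c, symmetric], subst integral_distr) (use assms in auto)

text \<open>Translation invariance makes every difference quotient of \<open>f\<close> along
  \<open>e\<close> integrate to 0. The mean value theorem bounds the quotients by \<open>M\<close>,
  and because the steps are at most 1 they all live on \<open>cball p (B + norm e)\<close>.
  Dominated convergence then gives the claim without slicing the space along
  \<open>e\<close>.\<close>

lemma integral_partial_derivative_eq_0:
  fixes f :: "'a::euclidean_space \<Rightarrow> real"
  assumes der: "\<And>x. (f has_derivative f' x) (at x)"
    and cont: "continuous_on UNIV (\<lambda>x. f' x e)"
    and supp: "\<And>x. x \<notin> cball p B \<Longrightarrow> f x = 0"
  shows "(\<integral>x. f' x e \<partial>lebesgue) = 0"
proof -
  have supp': "f' x e = 0" if "x \<notin> cball p B" for x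
    using has_derivative_zero_outside[OF der closed_cball that supp] by simp
  obtain M where M: "M \<ge> 0" "\<And>x. norm (f' x e) \<le> M"
    using continuous_compact_support_bounded[OF cont supp'] by blast
  have contf: "continuous_on UNIV f"
    using der by (meson continuous_at_imp_continuous_on has_derivative_continuous)
  define t where "t = (\<lambda>n. inverse (real (Suc n)))"
  have t: "0 < t n" "t n \<le> 1" for n
    unfolding t_def by (auto simp: field_simps)
  have t0: "t \<longlonglongrightarrow> 0" 
    unfolding t_def by (rule LIMSEQ_inverse_real_of_nat)
  define s where "s = (\<lambda>n x. (f (t n *\<^sub>R e + x) - f x) / t n)"
  have line: "((\<lambda>h. f (h *\<^sub>R e + x)) has_derivative (\<lambda>h. f' (y *\<^sub>R e + x) (h *\<^sub>R e))) (at y)" for x y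
    by (rule has_derivative_compose[OF _ der]) (auto intro!: derivative_eq_intros)
  have lineD: "((\<lambda>h. f (h *\<^sub>R e + x)) has_real_derivative f' (y *\<^sub>R e + x) e) (at y)" for x y
  proof -
    have "f' (y *\<^sub>R e + x) (h *\<^sub>R e) = f' (y *\<^sub>R e + x) e * h" for h
      using linear_cmul[OF has_derivative_linear[OF der]] by simp
    then show ?thesis
      using line[of x y] by (simp add: has_field_derivative_def)
  qed
  have sbd: "\<bar>s n x\<bar> \<le> M * indicator (cball p (B + norm e)) x" for n x
  proof (cases "x \<in> cball p (B + norm e)")
    case True
    obtain z where z: "f (t n *\<^sub>R e + x) - f (0 *\<^sub>R e + x) = (t n - 0) * f' (z *\<^sub>R e + x) e"
      using MVT2[OF t(1)[of n], of "\<lambda>h. f (h *\<^sub>R e + x)" "\<lambda>y. f' (y *\<^sub>R e + x) e"] lineD by blast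
    then have "s n x = f' (z *\<^sub>R e + x) e"
      using t(1)[of n] by (simp add: s_def)
    with True M(2) show ?thesis by simp
  next
    case False
    have "norm (t n *\<^sub>R e) \<le> norm e"
      using t[of n] by (simp add: mult_left_le_one_le)
    moreover have "dist p x \<le> dist p (t n *\<^sub>R e + x) + norm (t n *\<^sub>R e)"
      by (smt (verit, best) add_diff_cancel_left' dist_norm dist_triangle add.commute norm_minus_commute)
    ultimately have "t n *\<^sub>R e + x \<notin> cball p B" "x \<notin> cball p B"
      using False norm_ge_zero[of e] unfolding mem_cball by linarith+
    then have "s n x = 0"
      by (simp add: s_def supp)
    then show ?thesis using M(1) by simp
  qed
  have slim: "(\<lambda>n. s n x) \<longlonglongrightarrow> f' x e" for x
  proof -
    have "((\<lambda>h. f (h *\<^sub>R e + x)) has_real_derivative f' x e) (at 0)"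
      using lineD[of x 0] by simp
    then have "((\<lambda>h. (f (h *\<^sub>R e + x) - f x) / h) \<longlongrightarrow> f' x e) (at 0)"
      by (simp add: has_field_derivative_iff)
    moreover have "filterlim t (at 0) sequentially"
      using t0 t(1) by (auto simp: filterlim_at intro!: always_eventually) (metis less_irrefl)
    ultimately show ?thesis
      unfolding s_def by (rule filterlim_compose)
  qed
  have cs: "continuous_on UNIV (s n)" for n
    unfolding s_def using t(1)[of n]
    by (intro continuous_intros continuous_on_compose2[OF contf]) auto
  have fint: "integrable lborel f"
  proof -
    have "(\<lambda>x. indicator (cball p B) x *\<^sub>R f x) = f"
    proof
      fix x
      show "indicator (cball p B) x *\<^sub>R f x = f x"
        using supp[of x] by (cases "x \<in> cball p B") auto
    qed
    then show ?thesis
      using borel_integrable_compact[of "cball p B" f] contf continuous_on_subset by force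
  qed
  have fm: "f \<in> borel_measurable borel"
    using contf by (rule borel_measurable_continuous_onI)
  have shift: "integrable lborel (\<lambda>x. f (c + x))" for c
    using fint by (subst (asm) lborel_distr_plus[of c, symmetric], subst (asm) integrable_distr_eq)
      (use fm in auto)
  have "integral\<^sup>L lebesgue (s n) = 0" for n
  proof -
    have "integral\<^sup>L lebesgue (s n) = integral\<^sup>L lborel (s n)"
      by (rule integral_completion) (use borel_measurable_continuous_onI[OF cs] in simp)
    also have "\<dots> = ((\<integral>x. f (t n *\<^sub>R e + x) \<partial>lborel) - integral\<^sup>L lborel f) / t n"
      unfolding s_def using shift fint by simp
    finally show ?thesis by (simp add: integral_translate[OF fm])
  qed
  moreover have "(\<lambda>n. integral\<^sup>L lebesgue (s n)) \<longlonglongrightarrow> (\<integral>x. f' x e \<partial>lebesgue)"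
    by (rule integral_dominated_convergence[OF _ _ integrable_indicator_cball[of M p "B + norm e"]])
       (use sbd slim cs cont in \<open>auto intro!: lebesgue_measurable_continuous\<close>)
  ultimately show ?thesis
    by (simp add: LIMSEQ_const_iff)
qed

lemma C_k_1:
  "C_k 1 f \<longleftrightarrow> (\<exists>f'. (\<forall>x. (f has_derivative f' x) (at x)) \<and> (\<forall>i\<in>Basis. continuous_on UNIV (\<lambda>x. f' x i)))"
  by simp

lemma C_k_1_D:
  assumes "C_k 1 f"
  shows "(f has_derivative frechet_derivative f (at x)) (at x)"
    and "i \<in> Basis \<Longrightarrow> continuous_on UNIV (\<lambda>x. frechet_derivative f (at x) i)"
    and "continuous_on UNIV f"
proof -
  obtain f' where f': "\<And>x. (f has_derivative f' x) (at x)" "\<And>i. i \<in> Basis \<Longrightarrow> continuous_on UNIV (\<lambda>x. f' x i)"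
    using assms unfolding C_k_1 by blast
  have eq: "frechet_derivative f (at x) = f' x" for x
    using frechet_derivative_at[OF f'(1)] by simp
  show "(f has_derivative frechet_derivative f (at x)) (at x)"
    and "i \<in> Basis \<Longrightarrow> continuous_on UNIV (\<lambda>x. frechet_derivative f (at x) i)"
    using f' by (auto simp: eq)
  show "continuous_on UNIV f"
    using f'(1) by (meson continuous_at_imp_continuous_on has_derivative_continuous)
qed

lemma continuous_on_divergence:
  assumes "C_k 1 \<phi>"
  shows "continuous_on UNIV (divergence \<phi>)"
  unfolding divergence_def by (intro continuous_intros C_k_1_D assms)

lemma frechet_derivative_eq_sum:
  fixes f :: "'a::euclidean_space \<Rightarrow> real"
  assumes "(f has_derivative f') (at x)"
  shows "f' v = (\<Sum>i\<in>Basis. (v \<bullet> i) * f' i)"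
proof -
  have lin: "linear f'" using assms has_derivative_linear by blast
  have "f' v = f' (\<Sum>i\<in>Basis. (v \<bullet> i) *\<^sub>R i)"
    by (simp add: euclidean_representation)
  also have "\<dots> = (\<Sum>i\<in>Basis. (v \<bullet> i) * f' i)"
    by (simp add: linear_sum[OF lin] linear_cmul[OF lin])
  finally show ?thesis .
qed

text \<open>The integrand is div (f W), so \<open>integral_partial_derivative_eq_0\<close> applies
  to each component. The support condition concerns the product because compact support comes either
  from the field (\<open>yn n\<close> against a test function) or from the function (a cutoff
  against an arbitrary field or x - p). The other two claims provide integrability.\<close>

lemma integral_by_parts_divergence:
  fixes f :: "'a::euclidean_space \<Rightarrow> real" and W :: "'a \<Rightarrow> 'a"
  assumes f: "C_k 1 f" and W: "C_k 1 W" and supp: "\<And>x. x \<notin> cball p B \<Longrightarrow> f x *\<^sub>R W x = 0"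
  shows "(\<integral>x. frechet_derivative f (at x) (W x) + f x * divergence W x \<partial>lebesgue) = 0"
    and "continuous_on UNIV (\<lambda>x. frechet_derivative f (at x) (W x) + f x * divergence W x)"
    and "x \<notin> cball p B \<Longrightarrow> frechet_derivative f (at x) (W x) + f x * divergence W x = 0"
proof -
  let ?f = "\<lambda>x. frechet_derivative f (at x)" and ?W = "\<lambda>x. frechet_derivative W (at x)"
  define h' where "h' = (\<lambda>i x v. f x * (?W x v \<bullet> i) + ?f x v * (W x \<bullet> i))"
  have der: "((\<lambda>x. f x * (W x \<bullet> i)) has_derivative h' i x) (at x)" for i x
    unfolding h'_def by (rule derivative_eq_intros C_k_1_D[OF f] C_k_1_D[OF W] refl)+
  have cont: "continuous_on UNIV (\<lambda>x. h' i x i)" if "i \<in> Basis" for i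
    unfolding h'_def by (intro continuous_intros C_k_1_D f W that)
  have supp0: "f x * (W x \<bullet> i) = 0" if "x \<notin> cball p B" for i x
    using supp[OF that] by (auto simp: scaleR_eq_0_iff)
  have supp': "h' i x i = 0" if "x \<notin> cball p B" for i x
    using has_derivative_zero_outside[OF der closed_cball that supp0] by simp
  have eq: "?f x (W x) + f x * divergence W x = (\<Sum>i\<in>Basis. h' i x i)" for x
    unfolding h'_def divergence_def sum.distrib sum_distrib_left
    by (subst frechet_derivative_eq_sum[OF C_k_1_D(1)[OF f]]) (simp add: mult.commute)
  have int: "integrable lebesgue (\<lambda>x. h' i x i)" if i: "i \<in> Basis" for i
  proof -
    obtain M where "M \<ge> 0" "\<And>x. norm (h' i x i) \<le> M"
      using continuous_compact_support_bounded[OF cont[OF i] supp'] by blast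
    then show ?thesis
      using supp' by (intro integrable_bounded_support[of _ M p B] lebesgue_measurable_continuous cont i)
        (auto simp: indicator_def)
  qed
  show "(\<integral>x. ?f x (W x) + f x * divergence W x \<partial>lebesgue) = 0"
    unfolding eq using int integral_partial_derivative_eq_0[OF der cont supp0]
    by (subst Bochner_Integration.integral_sum) auto
  show "continuous_on UNIV (\<lambda>x. ?f x (W x) + f x * divergence W x)"
    unfolding eq by (intro continuous_intros cont)
  show "x \<notin> cball p B \<Longrightarrow> ?f x (W x) + f x * divergence W x = 0"
    unfolding eq using supp' by simp
qed

section \<open>Lipschitz radial fields\<close>

text \<open>The field \<open>y\<close> below is only Lipschitz.  Replacing its profile \<open>g\<close> by forward averages gives
  \<open>C\<^sup>1\<close> fields, and since \<open>g\<close> is decreasing this increases neither the norm nor the support.\<close>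

locale radial_profile =
  fixes p :: "'a::euclidean_space" and g g' :: "real \<Rightarrow> real" and S L :: real and T :: "real set"
  assumes antimono_g: "antimono g" and lipschitz_g: "\<And>s t. \<bar>g s - g t\<bar> \<le> L * \<bar>s - t\<bar>"
    and S_nonneg: "0 \<le> S" and g_support: "\<And>s. S \<le> s \<Longrightarrow> g s = 0"
    and g_bound: "\<And>s. 0 \<le> s \<Longrightarrow> sqrt s * g s \<le> 1"
    and finite_T: "finite T"
    and deriv_g: "\<And>s. 0 \<le> s \<Longrightarrow> s \<notin> T \<Longrightarrow> (g has_real_derivative g' s) (at s)"
    and measurable_g': "g' \<in> borel_measurable borel"
begin

definition y :: "'a \<Rightarrow> 'a" where
  "y x = g ((x - p) \<bullet> (x - p)) *\<^sub>R (x - p)"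

text \<open>The divergence of \<open>y\<close> off the kinks: with s = |x - p|^2 the gradient of
  g(s) is 2 g'(s) (x - p). A profile in s rather than in |x - p| avoids a singular derivative at the
  centre.\<close>

definition d :: "'a \<Rightarrow> real" where
  "d x = real DIM('a) * g ((x - p) \<bullet> (x - p)) + 2 * ((x - p) \<bullet> (x - p)) * g' ((x - p) \<bullet> (x - p))"

lemma L_nonneg: "0 \<le> L"
  using lipschitz_g[of 0 1] by (smt (verit) abs_ge_zero mult_cancel_left1)

lemma g_nonneg: "0 \<le> g s"
  using antimonoD[OF antimono_g, of s "max s S"] g_support[of "max s S"] by simp

lemma isCont_g: "isCont g s"
  unfolding continuous_at_eps_delta
proof (intro allI impI)
  fix e :: real assume "e > 0"
  then show "\<exists>k>0. \<forall>x'. dist x' s < k \<longrightarrow> dist (g x') (g s) < e"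
  proof (intro exI[of _ "e / (L + 1)"] conjI allI impI)
    show "0 < e / (L + 1)" using \<open>e > 0\<close> L_nonneg by simp
    fix x' assume a: "dist x' s < e / (L + 1)"
    have "dist (g x') (g s) \<le> L * dist x' s"
      using lipschitz_g[of x' s] by (simp add: dist_real_def)
    also have "\<dots> \<le> (L + 1) * dist x' s"
      by (simp add: mult_right_mono)
    also have "\<dots> < e"
      using a L_nonneg by (simp add: field_simps)
    finally show "dist (g x') (g s) < e" .
  qed
qed

lemma continuous_on_g: "continuous_on A g"
  by (simp add: continuous_at_imp_continuous_on isCont_g)

lemma norm_y: "norm (y x) \<le> 1"
  using g_bound[of "(x - p) \<bullet> (x - p)"] g_nonneg
  by (simp add: y_def mult.commute flip: norm_eq_sqrt_inner)

lemma continuous_on_y: "continuous_on UNIV y"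
  unfolding y_def by (intro continuous_intros continuous_on_compose2[OF continuous_on_g[of UNIV]]) auto

lemma outside_support: "x \<notin> cball p (sqrt S) \<Longrightarrow> S < (x - p) \<bullet> (x - p)"
  by (metis dist_commute dist_norm mem_cball not_less norm_eq_sqrt_inner real_sqrt_le_mono)

lemma y_support: "x \<notin> cball p (sqrt S) \<Longrightarrow> y x = 0"
  using outside_support[of x] g_support by (simp add: y_def)

section \<open>Smoothing by forward averages\<close>

definition P :: "real \<Rightarrow> real" where
  "P = (SOME P. \<forall>s. (P has_real_derivative g s) (at s))"

lemma deriv_P: "(P has_real_derivative g s) (at s)"
proof -
  have "\<exists>P. \<forall>s. (P has_real_derivative g s) (at s)"
    using einterval_antiderivative[of "-\<infinity>" \<infinity> g] isCont_g
    by (simp add: has_real_derivative_iff_has_vector_derivative)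
  then show ?thesis
    unfolding P_def by (rule someI2_ex) blast
qed

definition step :: "nat \<Rightarrow> real" where
  "step n = inverse (real (Suc n))"

text \<open>The mean of \<open>g\<close> over [s, s + step n], written with the antiderivative
  \<open>P\<close>. Its derivative \<open>avg'\<close> is a difference quotient of \<open>g\<close>,
  which yields both the bound by \<open>L\<close> and the convergence to \<open>g'\<close> off
  \<open>T\<close>.\<close>

definition avg :: "nat \<Rightarrow> real \<Rightarrow> real" where
  "avg n s = (P (s + step n) - P s) / step n"

definition avg' :: "nat \<Rightarrow> real \<Rightarrow> real" where
  "avg' n s = (g (s + step n) - g s) / step n"

definition yn :: "nat \<Rightarrow> 'a \<Rightarrow> 'a" where
  "yn n x = avg n ((x - p) \<bullet> (x - p)) *\<^sub>R (x - p)"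

lemma step_pos: "0 < step n"
  by (simp add: step_def)

lemma filterlim_step: "filterlim step (at 0) sequentially"
  using LIMSEQ_inverse_real_of_nat step_pos
  by (auto simp: filterlim_at step_def [abs_def] intro!: always_eventually)

lemma deriv_avg: "(avg n has_real_derivative avg' n s) (at s)"
  unfolding avg_def avg'_def using step_pos[of n]
  by (auto intro!: derivative_eq_intros DERIV_shift[THEN iffD1] deriv_P DERIV_cdivide DERIV_diff)

text \<open>By the mean value theorem the average is a value of \<open>g\<close> at a point to the
  right of s.\<close>

lemma avg_bounds: "0 \<le> avg n s" "avg n s \<le> g s"
proof -
  obtain \<xi> where "s < \<xi>" "\<xi> < s + step n" "P (s + step n) - P s = (s + step n - s) * g \<xi>"
    using MVT2[of s "s + step n" P g] deriv_P step_pos by auto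
  then have "avg n s = g \<xi>" "s \<le> \<xi>"
    using step_pos[of n] by (auto simp: avg_def)
  then show "0 \<le> avg n s" "avg n s \<le> g s"
    using g_nonneg antimonoD[OF antimono_g] by auto
qed

lemma avg'_bound: "\<bar>avg' n s\<bar> \<le> L"
  using lipschitz_g[of "s + step n" s] step_pos[of n] by (simp add: avg'_def field_simps)

lemma avg_tendsto: "(\<lambda>n. avg n s) \<longlonglongrightarrow> g s"
  unfolding avg_def
  by (rule filterlim_compose[OF _ filterlim_step]) (use deriv_P[of s] in \<open>simp add: DERIV_def\<close>)

lemma avg'_tendsto: "0 \<le> s \<Longrightarrow> s \<notin> T \<Longrightarrow> (\<lambda>n. avg' n s) \<longlonglongrightarrow> g' s"
  unfolding avg'_def
  by (rule filterlim_compose[OF _ filterlim_step]) (use deriv_g[of s] in \<open>simp add: DERIV_def\<close>)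

lemma avg_support: "S \<le> s \<Longrightarrow> avg n s = 0" "S \<le> s \<Longrightarrow> avg' n s = 0"
  using avg_bounds[of n s] g_support[of s] g_support[of "s + step n"] step_pos[of n]
  by (auto simp: avg'_def)

lemma has_derivative_yn:
  "(yn n has_derivative (\<lambda>h. (avg' n ((x - p) \<bullet> (x - p)) * (2 * ((x - p) \<bullet> h))) *\<^sub>R (x - p)
      + avg n ((x - p) \<bullet> (x - p)) *\<^sub>R h)) (at x)"
proof -
  have "((\<lambda>x. (x - p) \<bullet> (x - p)) has_derivative (\<lambda>h. 2 * ((x - p) \<bullet> h))) (at x)"
    by (auto intro!: derivative_eq_intros simp: inner_commute)
  from has_derivative_compose[OF this deriv_avg[unfolded has_field_derivative_def]]
  have "((\<lambda>x. avg n ((x - p) \<bullet> (x - p))) has_derivative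
      (\<lambda>h. avg' n ((x - p) \<bullet> (x - p)) * (2 * ((x - p) \<bullet> h)))) (at x)" .
  moreover have "((\<lambda>x. x - p) has_derivative (\<lambda>h. h)) (at x)"
    by (auto intro!: derivative_eq_intros)
  ultimately show ?thesis
    unfolding yn_def using has_derivative_scaleR by (subst add.commute) blast
qed

lemma C_k_yn: "C_k 1 (yn n)"
proof -
  have c: "continuous_on UNIV (avg n)" "continuous_on UNIV (avg' n)"
    using deriv_avg DERIV_isCont continuous_at_imp_continuous_on apply blast
    unfolding avg'_def using step_pos[of n]
    by (intro continuous_intros continuous_on_compose2[OF continuous_on_g[of UNIV]]) auto
  show ?thesis
    unfolding C_k_1
    by (intro exI conjI allI ballI, rule has_derivative_yn)
       (intro continuous_intros continuous_on_compose2[OF c(1)] continuous_on_compose2[OF c(2)]; simp)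
qed

lemma divergence_yn:
  "divergence (yn n) x =
     real DIM('a) * avg n ((x - p) \<bullet> (x - p)) + 2 * ((x - p) \<bullet> (x - p)) * avg' n ((x - p) \<bullet> (x - p))"
proof -
  define s where "s = (x - p) \<bullet> (x - p)"
  have "divergence (yn n) x = (\<Sum>i\<in>Basis. 2 * avg' n s * (((x - p) \<bullet> i) * ((x - p) \<bullet> i)) + avg n s * (i \<bullet> i))"
    unfolding divergence_def frechet_derivative_at[OF has_derivative_yn, symmetric] s_def
    by (intro sum.cong) (auto simp: inner_add_left)
  also have "\<dots> = 2 * avg' n s * s + avg n s * real DIM('a)"
    by (simp add: sum.distrib s_def euclidean_inner[of "x - p" "x - p"] flip: sum_distrib_left)
  finally show ?thesis
    by (simp add: s_def)
qed

lemma yn_support: "x \<notin> cball p (sqrt S) \<Longrightarrow> yn n x = 0"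
  using outside_support avg_support by (simp add: yn_def less_imp_le)

lemma divergence_yn_support: "x \<notin> cball p (sqrt S) \<Longrightarrow> divergence (yn n) x = 0"
  using outside_support[of x] avg_support by (simp add: divergence_yn less_imp_le)

lemma norm_yn: "norm (yn n x) \<le> 1"
proof -
  have "norm (yn n x) \<le> norm (y x)"
    using avg_bounds[of n] g_nonneg by (auto simp: yn_def y_def intro!: mult_right_mono)
  then show ?thesis using norm_y[of x] by linarith
qed

lemma yn_tendsto: "(\<lambda>n. yn n x) \<longlonglongrightarrow> y x"
  unfolding yn_def y_def by (intro tendsto_intros avg_tendsto)

lemma negligible_kinks: "negligible {x. (x - p) \<bullet> (x - p) \<in> T}"
proof (rule negligible_subset)
  show "negligible (\<Union>\<tau>\<in>T. sphere p (sqrt \<tau>))"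
    using finite_T by (auto intro!: negligible_Union negligible_sphere)
  show "{x. (x - p) \<bullet> (x - p) \<in> T} \<subseteq> (\<Union>\<tau>\<in>T. sphere p (sqrt \<tau>))"
    by (auto simp: dist_commute dist_norm norm_eq_sqrt_inner)
qed

lemma divergence_yn_tendsto: "AE x in lebesgue. (\<lambda>n. divergence (yn n) x) \<longlonglongrightarrow> d x"
proof -
  have "AE x in lebesgue. x \<notin> {x. (x - p) \<bullet> (x - p) \<in> T}"
    using negligible_kinks by (intro AE_not_in) (simp add: negligible_iff_null_sets)
  then show ?thesis
  proof eventually_elim
    case (elim x)
    then show ?case
      unfolding divergence_yn d_def by (intro tendsto_intros avg_tendsto avg'_tendsto) auto
  qed
qed

text \<open>Dominates all the divergences: \<open>avg\<close> is at most \<open>g 0\<close> on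
  nonnegative arguments because \<open>g\<close> decreases, and s \<le> S with the Lipschitz
  constant \<open>L\<close> controls the other term.\<close>

definition M :: real where
  "M = real DIM('a) * g 0 + 2 * S * L"

lemma M_nonneg: "0 \<le> M"
  using g_nonneg[of 0] S_nonneg L_nonneg by (simp add: M_def)

lemma divergence_yn_bound: "\<bar>divergence (yn n) x\<bar> \<le> M * indicator (cball p (sqrt S)) x"
proof (cases "x \<in> cball p (sqrt S)")
  case True
  define s where "s = (x - p) \<bullet> (x - p)"
  have s: "0 \<le> s" "s \<le> S"
    using True by (auto simp: s_def dist_norm norm_minus_commute[of p] simp flip: norm_eq_sqrt_inner)
       (simp add: norm_eq_sqrt_inner)
  have "\<bar>avg n s\<bar> \<le> g 0"
    using avg_bounds[of n s] antimonoD[OF antimono_g s(1)] by simp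
  then have "\<bar>real DIM('a) * avg n s\<bar> \<le> real DIM('a) * g 0"
    by (simp add: abs_mult)
  moreover have "\<bar>2 * s * avg' n s\<bar> \<le> 2 * S * L"
    using s avg'_bound[of n s] S_nonneg by (auto simp: abs_mult intro!: mult_mono)
  ultimately show ?thesis
    using True unfolding divergence_yn M_def s_def[symmetric] by simp
qed (simp add: divergence_yn_support)

lemma d_measurable: "d \<in> borel_measurable borel"
  unfolding d_def using measurable_g' borel_measurable_continuous_onI[OF continuous_on_g[of UNIV]]
  by measurable

lemma d_bound: "AE x in lebesgue. \<bar>d x\<bar> \<le> M * indicator (cball p (sqrt S)) x"
  using divergence_yn_tendsto
proof eventually_elim
  case (elim x)
  show ?case
    by (rule LIMSEQ_le_const2[OF tendsto_rabs[OF elim]]) (use divergence_yn_bound in blast)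
qed

lemma d_integrable: "integrable lebesgue d"
  using d_measurable d_bound by (intro integrable_bounded_support) (auto intro: measurable_completion)

section \<open>Pairing the Lipschitz field with functions on \<Omega>\<close>

context
  fixes \<Omega> :: "'a set"
  assumes \<Omega>: "open \<Omega>" and support_subset: "cball p (sqrt S) \<subseteq> \<Omega>"
begin

lemma lebesgue_on_measurable:
  "f \<in> borel_measurable borel \<Longrightarrow> f \<in> borel_measurable (lebesgue_on \<Omega>)"
  by (intro measurable_restrict_space1 measurable_completion) simp

lemma AE_lebesgue_on: "AE x in lebesgue. Q x \<Longrightarrow> AE x in lebesgue_on \<Omega>. Q x"
  using \<Omega> by (simp add: AE_restrict_space_iff) (auto elim: eventually_mono)

lemma yn_compactly_supported: "compactly_supported_in \<Omega> (yn n)"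
proof -
  have "closure {x. yn n x \<noteq> 0} \<subseteq> cball p (sqrt S)"
    using yn_support[of _ n] by (intro closure_minimal) fastforce+
  then show ?thesis
    using support_subset bounded_subset[OF bounded_cball] closure_subset
    unfolding compactly_supported_in_def compact_closure by blast
qed

text \<open>This is the calibration inequality. Each \<open>yn n\<close> competes in the supremum,
  and the bound \<open>M * \<bar>v x\<bar>\<close> lets dominated convergence carry the inequality
  to the limit field for every integrable \<open>v\<close>, of finite variation or not.\<close>

lemma integral_le_total_variation:
  assumes v: "integrable (lebesgue_on \<Omega>) v"
  shows "integrable (lebesgue_on \<Omega>) (\<lambda>x. v x * d x)"
    and "ereal (\<integral>x. v x * d x \<partial>lebesgue_on \<Omega>) \<le> total_variation \<Omega> v"
proof -
  have [measurable]: "v \<in> borel_measurable (lebesgue_on \<Omega>)" "d \<in> borel_measurable (lebesgue_on \<Omega>)"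
    "divergence (yn n) \<in> borel_measurable (lebesgue_on \<Omega>)" for n
    using v borel_measurable_continuous_onI[OF continuous_on_divergence[OF C_k_yn]]
    by (auto intro: lebesgue_on_measurable d_measurable)
  have lim: "AE x in lebesgue_on \<Omega>. (\<lambda>n. v x * divergence (yn n) x) \<longlonglongrightarrow> v x * d x"
    using AE_lebesgue_on[OF divergence_yn_tendsto] by eventually_elim (intro tendsto_intros)
  have w: "integrable (lebesgue_on \<Omega>) (\<lambda>x. M * \<bar>v x\<bar>)"
    using v by (intro integrable_mult_right integrable_abs)
  have bound: "AE x in lebesgue_on \<Omega>. norm (v x * divergence (yn n) x) \<le> M * \<bar>v x\<bar>" for n
  proof (intro always_eventually allI)
    fix x
    have "\<bar>divergence (yn n) x\<bar> \<le> M"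
      using divergence_yn_bound[of n x] M_nonneg by (cases "x \<in> cball p (sqrt S)") auto
    then show "norm (v x * divergence (yn n) x) \<le> M * \<bar>v x\<bar>"
      unfolding real_norm_def abs_mult by (subst mult.commute) (rule mult_right_mono; simp)
  qed
  show "integrable (lebesgue_on \<Omega>) (\<lambda>x. v x * d x)"
    by (rule integrable_dominated_convergence[OF _ _ w lim bound]) measurable
  have conv: "(\<lambda>n. \<integral>x. v x * divergence (yn n) x \<partial>lebesgue_on \<Omega>) \<longlonglongrightarrow> (\<integral>x. v x * d x \<partial>lebesgue_on \<Omega>)"
    by (rule integral_dominated_convergence[OF _ _ w lim bound]) measurable
  have "ereal (\<integral>x. v x * divergence (yn n) x \<partial>lebesgue_on \<Omega>) \<le> total_variation \<Omega> v" for n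
    unfolding total_variation_def
    using C_k_yn yn_compactly_supported norm_yn by (intro SUP_upper) auto
  with conv show "ereal (\<integral>x. v x * d x \<partial>lebesgue_on \<Omega>) \<le> total_variation \<Omega> v"
    by (intro LIMSEQ_le_const2[of "\<lambda>n. ereal (\<integral>x. v x * divergence (yn n) x \<partial>lebesgue_on \<Omega>)"]) auto
qed

text \<open>Integration by parts holds for every \<open>yn n\<close> on the whole space, and
  dominated convergence passes to \<open>y\<close> and \<open>d\<close>. Integrals over \<Omega> and
  over the whole space agree because \<open>y\<close> vanishes outside a ball inside \<Omega>, and
  \<open>d\<close> does so almost everywhere.\<close>

lemma weak_divergence: "has_weak_divergence \<Omega> (\<lambda>x. - y x) (\<lambda>x. - d x)"
  unfolding has_weak_divergence_def
proof (intro conjI allI impI; elim conjE)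
  fix K :: "'a set" assume "compact K"
  then have "K \<in> sets lebesgue"
    by (simp add: lmeasurable_compact fmeasurableD)
  then show "integrable (lebesgue_on K) (\<lambda>x. - d x)"
    using integrable_mult_indicator[OF _ d_integrable, of K]
    by (intro integrable_restrict_space[THEN iffD2]) auto
next
  fix \<phi> :: "'a \<Rightarrow> real"
  assume "C_infinity \<phi>"
  then have \<phi>: "C_k 1 \<phi>" by (simp add: C_infinity_def)
  let ?D = "\<lambda>x. frechet_derivative \<phi> (at x)"
  let ?K = "cball p (sqrt S)"
  have lin: "linear (?D x)" for x
    using C_k_1_D(1)[OF \<phi>] has_derivative_linear by blast
  \<comment> \<open>A continuous majorant on the support ball: the sum bounds the derivative of
    \<phi> along any vector of norm at most 1, and the last term bounds \<phi> times any divergence.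
    Its bound \<open>B\<close> there dominates all integrands below.\<close>
  define E where "E x = (\<Sum>i\<in>Basis. \<bar>?D x i\<bar>) + \<bar>\<phi> x\<bar> * M" for x
  have contE: "continuous_on UNIV E"
    unfolding E_def by (intro continuous_intros C_k_1_D[OF \<phi>])
  then have "bounded (E ` ?K)"
    by (intro compact_imp_bounded compact_continuous_image) (auto intro: continuous_on_subset)
  then obtain B where B: "\<And>x. x \<in> ?K \<Longrightarrow> \<bar>E x\<bar> \<le> B"
    unfolding bounded_iff by (metis imageI real_norm_def)
  have Dsum: "?D x w = (\<Sum>i\<in>Basis. (w \<bullet> i) * ?D x i)" for x w
    by (rule frechet_derivative_eq_sum[OF C_k_1_D(1)[OF \<phi>]])
  have D_le: "\<bar>?D x w\<bar> \<le> (\<Sum>i\<in>Basis. \<bar>?D x i\<bar>)" if "norm w \<le> 1" for x w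
  proof -
    have "\<bar>(w \<bullet> i) * ?D x i\<bar> \<le> \<bar>?D x i\<bar>" if "i \<in> Basis" for i
      using Basis_le_norm[OF that, of w] \<open>norm w \<le> 1\<close> by (simp add: abs_mult mult_left_le_one_le)
    then have "\<bar>\<Sum>i\<in>Basis. (w \<bullet> i) * ?D x i\<bar> \<le> (\<Sum>i\<in>Basis. \<bar>?D x i\<bar>)"
      by (intro order_trans[OF sum_abs] sum_mono)
    then show ?thesis
      by (subst Dsum)
  qed
  have contD: "continuous_on UNIV (\<lambda>x. ?D x (w x))" if "continuous_on UNIV w" for w
    by (subst Dsum) (intro continuous_intros C_k_1_D[OF \<phi>] that)
  have m1: "(\<lambda>x. ?D x (y x)) \<in> borel_measurable lebesgue"
    by (intro lebesgue_measurable_continuous contD continuous_on_y)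
  have m2: "(\<lambda>x. \<phi> x * d x) \<in> borel_measurable lebesgue"
    using d_measurable
    by (intro borel_measurable_times lebesgue_measurable_continuous C_k_1_D(3)[OF \<phi>] measurable_completion) auto
  have supp_d: "AE x in lebesgue. x \<notin> ?K \<longrightarrow> d x = 0"
    using d_bound by eventually_elim (auto simp: indicator_def)
  have D0: "?D x (y x) = 0" if "x \<notin> ?K" for x
    using that y_support linear_0[OF lin] by simp
  have b1: "\<bar>?D x w\<bar> \<le> B" if "x \<in> ?K" "norm w \<le> 1" for x w
    using B[OF that(1)] D_le[OF that(2), of x] mult_nonneg_nonneg[OF abs_ge_zero[of "\<phi> x"] M_nonneg]
    unfolding E_def by linarith
  have i1: "integrable lebesgue (\<lambda>x. ?D x (y x))"
    by (rule integrable_bounded_support[OF m1, of B p "sqrt S"], rule always_eventually)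
       (use b1 norm_y D0 in \<open>auto simp: indicator_def\<close>)
  have le_E: "\<bar>\<phi> x * c\<bar> \<le> \<bar>\<phi> x\<bar> * M" if "\<bar>c\<bar> \<le> M" for x c
    using that by (simp add: abs_mult mult_left_mono)
  have sum_nn: "0 \<le> (\<Sum>i\<in>Basis. \<bar>?D x i\<bar>)" for x
    by (simp add: sum_nonneg)
  have i2: "integrable lebesgue (\<lambda>x. \<phi> x * d x)"
  proof (rule integrable_bounded_support[OF m2, of B p "sqrt S"])
    show "AE x in lebesgue. \<bar>\<phi> x * d x\<bar> \<le> B * indicator ?K x"
      using d_bound
    proof eventually_elim
      case (elim x)
      show ?case
      proof (cases "x \<in> ?K")
        case True
        with elim have "\<bar>\<phi> x * d x\<bar> \<le> \<bar>\<phi> x\<bar> * M" by (intro le_E) simp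
        then have "\<bar>\<phi> x * d x\<bar> \<le> B" using B[OF True] sum_nn[of x] unfolding E_def by linarith
        with True show ?thesis by simp
      qed (use elim in simp)
    qed
  qed
  let ?h = "\<lambda>n x. ?D x (yn n x) + \<phi> x * divergence (yn n) x"
  have "(\<lambda>n. integral\<^sup>L lebesgue (?h n)) \<longlonglongrightarrow> (\<integral>x. ?D x (y x) + \<phi> x * d x \<partial>lebesgue)"
  proof (rule integral_dominated_convergence[OF _ _ integrable_indicator_cball[of B p "sqrt S"]])
    show "(\<lambda>x. ?D x (y x) + \<phi> x * d x) \<in> borel_measurable lebesgue"
      using m1 m2 by (rule borel_measurable_add)
    show "?h n \<in> borel_measurable lebesgue" for n
      by (intro lebesgue_measurable_continuous integral_by_parts_divergence[OF \<phi> C_k_yn, where p=p and B="sqrt S"])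
         (simp add: yn_support)
    show "AE x in lebesgue. (\<lambda>n. ?h n x) \<longlonglongrightarrow> ?D x (y x) + \<phi> x * d x"
      using divergence_yn_tendsto
    proof eventually_elim
      case (elim x)
      have "(\<lambda>n. ?D x (yn n x)) \<longlonglongrightarrow> ?D x (y x)"
        by (subst Dsum, subst Dsum[of x "y x"]) (intro tendsto_intros yn_tendsto)
      with elim show ?case by (intro tendsto_intros)
    qed
    show "AE x in lebesgue. norm (?h n x) \<le> B * indicator ?K x" for n
    proof (intro always_eventually allI)
      fix x
      show "norm (?h n x) \<le> B * indicator ?K x"
      proof (cases "x \<in> ?K")
        case True
        then have "\<bar>divergence (yn n) x\<bar> \<le> M"
          using divergence_yn_bound[of n x] by simp
        then have "\<bar>?h n x\<bar> \<le> B"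
          using le_E[of "divergence (yn n) x" x] D_le[OF norm_yn[of n x], of x] B[OF True]
          unfolding E_def by linarith
        with True show ?thesis by simp
      next
        case False
        then show ?thesis
          using yn_support[OF False] divergence_yn_support[OF False] linear_0[OF lin] by simp
      qed
    qed
  qed
  moreover have "integral\<^sup>L lebesgue (?h n) = 0" for n
    by (rule integral_by_parts_divergence(1)[OF \<phi> C_k_yn, where p=p and B="sqrt S"]) (simp add: yn_support)
  ultimately have "(\<integral>x. ?D x (y x) + \<phi> x * d x \<partial>lebesgue) = 0"
    by (simp add: LIMSEQ_const_iff)
  then have *: "(\<integral>x. ?D x (y x) \<partial>lebesgue) = - (\<integral>x. \<phi> x * d x \<partial>lebesgue)"
    using i1 i2 by simp
  have r1: "(\<integral>x. ?D x (- y x) \<partial>lebesgue_on \<Omega>) = - (\<integral>x. ?D x (y x) \<partial>lebesgue)"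
  proof -
    have "(\<integral>x. ?D x (- y x) \<partial>lebesgue_on \<Omega>) = (\<integral>x. - (?D x (y x)) \<partial>lebesgue)"
    proof (subst integral_restrict_space)
      show "(\<integral>x. indicator \<Omega> x *\<^sub>R ?D x (- y x) \<partial>lebesgue) = (\<integral>x. - (?D x (y x)) \<partial>lebesgue)"
      proof (intro Bochner_Integration.integral_cong refl)
        fix x
        show "indicator \<Omega> x *\<^sub>R ?D x (- y x) = - (?D x (y x))"
          using D0[of x] subsetD[OF support_subset, of x] linear_neg[OF lin, of x "y x"]
          by (cases "x \<in> \<Omega>") auto
      qed
    qed (use \<Omega> in simp)
    then show ?thesis by simp
  qed
  have r2: "(\<integral>x. - d x * \<phi> x \<partial>lebesgue_on \<Omega>) = - (\<integral>x. \<phi> x * d x \<partial>lebesgue)"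
  proof -
    have m3: "(\<lambda>x. - d x * \<phi> x) \<in> borel_measurable lebesgue"
      using borel_measurable_uminus[OF m2] by (simp add: mult.commute)
    have "(\<integral>x. - d x * \<phi> x \<partial>lebesgue_on \<Omega>) = (\<integral>x. indicator \<Omega> x *\<^sub>R (- d x * \<phi> x) \<partial>lebesgue)"
      using \<Omega> by (subst integral_restrict_space) auto
    also have "\<dots> = (\<integral>x. - (\<phi> x * d x) \<partial>lebesgue)"
    proof (rule integral_cong_AE)
      show "AE x in lebesgue. indicator \<Omega> x *\<^sub>R (- d x * \<phi> x) = - (\<phi> x * d x)"
        using supp_d
      proof eventually_elim
        case (elim x)
        then show ?case
          using subsetD[OF support_subset, of x] by (cases "x \<in> \<Omega>") auto
      qed
      show "(\<lambda>x. indicator \<Omega> x *\<^sub>R (- d x * \<phi> x)) \<in> borel_measurable lebesgue"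
        using \<Omega> by (intro borel_measurable_scaleR borel_measurable_indicator m3) simp
    qed (use m2 in simp)
    finally show ?thesis by simp
  qed
  show "(\<integral>x. ?D x (- y x) \<partial>lebesgue_on \<Omega>) = - (\<integral>x. - d x * \<phi> x \<partial>lebesgue_on \<Omega>)"
    unfolding r1 r2 * by simp
qed

end

end

section \<open>The perimeter of a ball\<close>

text \<open>Unlike the positive part, its square is C^1, so composing it gives C^1 cutoffs by
  elementary formulas.\<close>

definition pos_sq :: "real \<Rightarrow> real" where
  "pos_sq s = (max 0 s)\<^sup>2"

lemma deriv_pos_sq: "(pos_sq has_real_derivative 2 * max 0 s) (at s)"
proof -
  consider "s > 0" | "s < 0" | "s = 0" by linarith
  then show ?thesis
  proof cases
    case 1
    have "((\<lambda>s. s\<^sup>2) has_real_derivative 2 * max 0 s) (at s)"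
      using 1 by (auto intro!: derivative_eq_intros)
    then show ?thesis
      by (rule has_field_derivative_transform_within_open[where S = "{0<..}"]) (use 1 in \<open>auto simp: pos_sq_def\<close>)
  next
    case 2
    have "((\<lambda>s. 0) has_real_derivative 2 * max 0 s) (at s)"
      using 2 by (auto intro!: derivative_eq_intros)
    then show ?thesis
      by (rule has_field_derivative_transform_within_open[where S = "{..<0}"]) (use 2 in \<open>auto simp: pos_sq_def\<close>)
  next
    case 3
    have "((\<lambda>h. pos_sq h / h) \<longlongrightarrow> 0) (at 0)"
    proof (rule Lim_null_comparison[where g = "\<lambda>h. \<bar>h\<bar>"])
      show "\<forall>\<^sub>F h in at 0. norm (pos_sq h / h) \<le> \<bar>h\<bar>"
        by (intro always_eventually) (auto simp: pos_sq_def max_def power2_eq_square)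
      show "((\<lambda>h::real. \<bar>h\<bar>) \<longlongrightarrow> 0) (at 0)"
        by (intro tendsto_eq_intros) auto
    qed
    then show ?thesis
      using 3 by (simp add: has_field_derivative_iff pos_sq_def)
  qed
qed

text \<open>A decreasing profile in s = |x - p|^2: 1 up to \<rho> and 0 from \<rho> + 1 / (n + 1)
  on. As the transition lies outside, the limit is the indicator of the closed ball.\<close>

definition cutoff :: "real \<Rightarrow> nat \<Rightarrow> real \<Rightarrow> real" where
  "cutoff \<rho> n s = pos_sq (1 - pos_sq (real (Suc n) * (s - \<rho>)))"

definition cutoff' :: "real \<Rightarrow> nat \<Rightarrow> real \<Rightarrow> real" where
  "cutoff' \<rho> n s = - (2 * max 0 (1 - pos_sq (real (Suc n) * (s - \<rho>))) *
     (2 * max 0 (real (Suc n) * (s - \<rho>)) * real (Suc n)))"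

lemma deriv_cutoff: "(cutoff \<rho> n has_real_derivative cutoff' \<rho> n s) (at s)"
proof -
  have "((\<lambda>s. real (Suc n) * (s - \<rho>)) has_real_derivative real (Suc n)) (at s)"
    by (auto intro!: derivative_eq_intros)
  from DERIV_chain2[OF deriv_pos_sq this]
  have "((\<lambda>s. 1 - pos_sq (real (Suc n) * (s - \<rho>))) has_real_derivative
      - (2 * max 0 (real (Suc n) * (s - \<rho>)) * real (Suc n))) (at s)"
    by (auto intro!: derivative_eq_intros)
  from DERIV_chain2[OF deriv_pos_sq this] show ?thesis
    unfolding cutoff_def cutoff'_def by simp
qed

lemma cutoff'_nonpos: "cutoff' \<rho> n s \<le> 0"
  by (simp add: cutoff'_def)

lemma cutoff'_eq_0: "s \<le> \<rho> \<Longrightarrow> cutoff' \<rho> n s = 0"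
  using mult_nonneg_nonpos[of "real (Suc n)" "s - \<rho>"] by (simp add: cutoff'_def max_absorb1 del: of_nat_Suc)

lemma continuous_cutoff': "continuous_on UNIV (cutoff' \<rho> n)"
  unfolding cutoff'_def pos_sq_def by (intro continuous_intros)

lemma cutoff_eq_1: "s \<le> \<rho> \<Longrightarrow> cutoff \<rho> n s = 1"
proof -
  assume "s \<le> \<rho>"
  then have "real (Suc n) * (s - \<rho>) \<le> 0" by (intro mult_nonneg_nonpos) auto
  then show ?thesis by (simp add: cutoff_def pos_sq_def)
qed

lemma cutoff_eq_0:
  assumes "1 \<le> real (Suc n) * (s - \<rho>)"
  shows "cutoff \<rho> n s = 0"
proof -
  have "1\<^sup>2 \<le> (real (Suc n) * (s - \<rho>))\<^sup>2"
    using assms by (intro power_mono) auto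
  then show ?thesis
    using assms by (simp add: cutoff_def pos_sq_def)
qed

lemma cutoff_bounds: "0 \<le> cutoff \<rho> n s" "cutoff \<rho> n s \<le> 1"
proof -
  have "0 \<le> pos_sq (real (Suc n) * (s - \<rho>))" by (simp add: pos_sq_def)
  then have "max 0 (1 - pos_sq (real (Suc n) * (s - \<rho>))) \<le> 1" by simp
  then show "cutoff \<rho> n s \<le> 1"
    unfolding cutoff_def pos_sq_def[of "1 - _"] by (intro power_le_one) auto
qed (simp add: cutoff_def pos_sq_def)

lemma cutoff_tendsto: "(\<lambda>n. cutoff \<rho> n s) \<longlonglongrightarrow> indicator {..\<rho>} s"
proof (cases "s \<le> \<rho>")
  case True
  then show ?thesis by (simp add: cutoff_eq_1)
next
  case False
  then obtain m where m: "1 < real m * (s - \<rho>)"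
    using reals_Archimedean3[of "s - \<rho>"] by auto
  have "\<forall>\<^sub>F n in sequentially. cutoff \<rho> n s = 0"
    unfolding eventually_sequentially
  proof (intro exI[of _ m] allI impI)
    fix n assume "m \<le> n"
    then have "real m * (s - \<rho>) \<le> real (Suc n) * (s - \<rho>)"
      using False by (intro mult_right_mono) auto
    with m show "cutoff \<rho> n s = 0" by (intro cutoff_eq_0) simp
  qed
  then show ?thesis
    using False by (simp add: tendsto_eventually)
qed

lemma C_k_shift: "C_k 1 (\<lambda>x. x - p)" and divergence_shift: "divergence (\<lambda>x. x - p) x = real DIM('a)"
  for p :: "'a::euclidean_space"
proof -
  have D: "((\<lambda>x. x - p) has_derivative (\<lambda>h. h)) (at x)" for x
    by (auto intro!: derivative_eq_intros)
  show "C_k 1 (\<lambda>x. x - p)"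
    unfolding C_k_1 by (intro exI[of _ "\<lambda>_ h. h"]) (use D in auto)
  show "divergence (\<lambda>x. x - p) x = real DIM('a)"
    unfolding divergence_def frechet_derivative_at[OF D, symmetric] by simp
qed

text \<open>The bound is the flux of (x - p) / r through the sphere, that is, its surface area. Both
  \<phi> and (x - p) / r are integrated by parts against cutoffs f. The gradient of f points inwards
  and lives at distance at least r, where (x - p) / r has the larger outward component; hence f (div
  \<phi> - N / r) has integral at most 0, and the cutoffs tend to the indicator of the ball.\<close>

lemma integral_divergence_ball_le:
  fixes p :: "'a::euclidean_space"
  assumes \<phi>: "C_k 1 \<phi>" "\<And>x. norm (\<phi> x) \<le> 1" and r: "0 < r"
  shows "(\<integral>x. indicator (cball p r) x * divergence \<phi> x \<partial>lebesgue)
      \<le> real DIM('a) / r * measure lebesgue (cball p r)"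
    and "integrable lebesgue (\<lambda>x. indicator (cball p r) x * divergence \<phi> x)"
proof -
  define f where "f = (\<lambda>n x. cutoff (r\<^sup>2) n ((x - p) \<bullet> (x - p)))"
  define f' where "f' = (\<lambda>n x h. cutoff' (r\<^sup>2) n ((x - p) \<bullet> (x - p)) * (2 * ((x - p) \<bullet> h)))"
  \<comment> \<open>The cutoffs vanish once |x - p|^2 \<ge> r^2 + 1 / (n + 1), so this ball contains
    all their supports.\<close>
  let ?K = "cball p (sqrt (r\<^sup>2 + 1))"
  have f_deriv: "(f n has_derivative f' n x) (at x)" for n x
  proof -
    have "((\<lambda>x. (x - p) \<bullet> (x - p)) has_derivative (\<lambda>h. 2 * ((x - p) \<bullet> h))) (at x)"
      by (auto intro!: derivative_eq_intros simp: inner_commute)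
    from has_derivative_compose[OF this deriv_cutoff[unfolded has_field_derivative_def]]
    show ?thesis unfolding f_def f'_def .
  qed
  have Ckf: "C_k 1 (f n)" for n
    unfolding C_k_1
  proof (intro exI[of _ "f' n"] conjI allI ballI f_deriv)
    fix i :: 'a
    show "continuous_on UNIV (\<lambda>x. f' n x i)"
      unfolding f'_def by (intro continuous_intros continuous_on_compose2[OF continuous_cutoff']) auto
  qed
  have frechet_f: "frechet_derivative (f n) (at x) = f' n x" for n x
    using frechet_derivative_at[OF f_deriv] by simp
  have f_supp: "f n x = 0" if "x \<notin> ?K" for n x
  proof -
    have "sqrt (r\<^sup>2 + 1) < sqrt ((x - p) \<bullet> (x - p))"
      using that by (simp add: dist_norm norm_minus_commute[of p] flip: norm_eq_sqrt_inner)
    then have "1 \<le> (x - p) \<bullet> (x - p) - r\<^sup>2" by simp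
    also have "\<dots> \<le> real (Suc n) * ((x - p) \<bullet> (x - p) - r\<^sup>2)"
      using mult_right_mono[of 1 "real (Suc n)" "(x - p) \<bullet> (x - p) - r\<^sup>2"] calculation by simp
    finally show ?thesis unfolding f_def by (rule cutoff_eq_0)
  qed
  note ibp\<phi> = integral_by_parts_divergence[OF Ckf \<phi>(1), where p = p and B = "sqrt (r\<^sup>2 + 1)"]
  note ibpx = integral_by_parts_divergence[OF Ckf C_k_shift[of p], where p = p and B = "sqrt (r\<^sup>2 + 1)"]
  let ?N = "real DIM('a)"
  have cdiv: "continuous_on UNIV (divergence \<phi>)" 
    by (rule continuous_on_divergence[OF \<phi>(1)])
  have integ: "integrable lebesgue h" if h: "continuous_on UNIV h" "\<And>x. x \<notin> ?K \<Longrightarrow> h x = 0" for h :: "'a \<Rightarrow> real"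
  proof -
    obtain M where "M \<ge> 0" "\<And>x. norm (h x) \<le> M"
      using continuous_compact_support_bounded[OF h] by blast
    then show ?thesis
      using h(2) by (intro integrable_bounded_support[of _ M p "sqrt (r\<^sup>2 + 1)"] lebesgue_measurable_continuous h(1))
        (auto simp: indicator_def)
  qed
  have cf: "continuous_on UNIV (f n)" for n
    using C_k_1_D(3)[OF Ckf] .
  have key: "f n x * (divergence \<phi> x - ?N / r) \<le>
      (f' n x (\<phi> x) + f n x * divergence \<phi> x) - (f' n x (x - p) + f n x * divergence (\<lambda>x. x - p) x) / r" for n x
  proof -
    define s where "s = (x - p) \<bullet> (x - p)"
    \<comment> \<open>Outside the ball r \<le> |x - p|, so the inner product of x - p with \<phi> is
      at most |x - p| \<le> |x - p|^2 / r. Multiplication by the nonpositive slope of the cutoff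
      reverses the inequality.\<close>
    have "f' n x (x - p) / r \<le> f' n x (\<phi> x)"
    proof (cases "s \<le> r\<^sup>2")
      case True
      then show ?thesis by (simp add: f'_def cutoff'_eq_0 s_def)
    next
      case False
      then have "r\<^sup>2 < (norm (x - p))\<^sup>2"
        by (simp add: s_def power2_norm_eq_inner)
      then have "r \<le> norm (x - p)"
        using r by (simp add: power_less_imp_less_base less_imp_le)
      have "(x - p) \<bullet> \<phi> x \<le> norm (x - p) * 1"
        using norm_cauchy_schwarz[of "x - p" "\<phi> x"] \<phi>(2)[of x] mult_left_mono[OF \<phi>(2)[of x], of "norm (x - p)"] by simp
      also have "\<dots> \<le> norm (x - p) * (norm (x - p) / r)"
        using \<open>r \<le> norm (x - p)\<close> r by (intro mult_left_mono) auto
      finally have "(x - p) \<bullet> \<phi> x \<le> (x - p) \<bullet> (x - p) / r"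
        by (simp add: power2_norm_eq_inner[symmetric] power2_eq_square)
      from mult_left_mono_neg[OF this, of "2 * cutoff' (r\<^sup>2) n s"] cutoff'_nonpos[of "r\<^sup>2" n s]
      show ?thesis unfolding f'_def s_def by (simp add: algebra_simps)
    qed
    then show ?thesis
      using r by (simp add: divergence_shift field_simps)
  qed
  have le0: "(\<integral>x. f n x * (divergence \<phi> x - ?N / r) \<partial>lebesgue) \<le> 0" for n
  proof -
    have i1: "integrable lebesgue (\<lambda>x. f' n x (\<phi> x) + f n x * divergence \<phi> x)"
      using ibp\<phi>(2,3)[of n] f_supp[of _ n] by (intro integ) (auto simp: frechet_f)
    have i2: "integrable lebesgue (\<lambda>x. f' n x (x - p) + f n x * divergence (\<lambda>x. x - p) x)"
      using ibpx(2,3)[of n] f_supp[of _ n] by (intro integ) (auto simp: frechet_f)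
    have "(\<integral>x. f n x * (divergence \<phi> x - ?N / r) \<partial>lebesgue) \<le>
      (\<integral>x. (f' n x (\<phi> x) + f n x * divergence \<phi> x) - (f' n x (x - p) + f n x * divergence (\<lambda>x. x - p) x) / r \<partial>lebesgue)"
      using f_supp by (intro integral_mono key Bochner_Integration.integrable_diff i1 integrable_divide i2 integ)
         (auto intro!: continuous_intros cf cdiv)
    also have "\<dots> = 0"
      using ibp\<phi>(1)[of n] ibpx(1)[of n] f_supp[of _ n] i1 i2 by (simp add: frechet_f)
    finally show ?thesis .
  qed
  have "bounded ((\<lambda>x. divergence \<phi> x - ?N / r) ` ?K)"
    by (intro compact_imp_bounded compact_continuous_image continuous_intros)
       (auto intro: continuous_on_subset cdiv)
  then obtain M where M: "\<And>x. x \<in> ?K \<Longrightarrow> \<bar>divergence \<phi> x - ?N / r\<bar> \<le> M"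
    unfolding bounded_iff by (metis imageI real_norm_def)
  have ind: "indicator {..r\<^sup>2} ((x - p) \<bullet> (x - p)) = indicat_real (cball p r) x" for x
  proof -
    have "(x - p) \<bullet> (x - p) \<le> r\<^sup>2 \<longleftrightarrow> norm (x - p) \<le> r"
      using r by (simp add: power2_norm_eq_inner[symmetric] abs_le_square_iff[symmetric])
    then show ?thesis
      by (simp add: indicator_def dist_norm norm_minus_commute[of p])
  qed
  have "(\<lambda>n. \<integral>x. f n x * (divergence \<phi> x - ?N / r) \<partial>lebesgue) \<longlonglongrightarrow>
      (\<integral>x. indicator (cball p r) x * (divergence \<phi> x - ?N / r) \<partial>lebesgue)"
  proof (rule integral_dominated_convergence[OF _ _ integrable_indicator_cball[of M p "sqrt (r\<^sup>2 + 1)"]])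
    show "(\<lambda>x. indicator (cball p r) x * (divergence \<phi> x - ?N / r)) \<in> borel_measurable lebesgue"
      by (intro borel_measurable_times borel_measurable_indicator lebesgue_measurable_continuous continuous_intros cdiv) auto
    show "(\<lambda>x. f n x * (divergence \<phi> x - ?N / r)) \<in> borel_measurable lebesgue" for n
      by (intro lebesgue_measurable_continuous continuous_intros cdiv cf)
    show "AE x in lebesgue. (\<lambda>n. f n x * (divergence \<phi> x - ?N / r)) \<longlonglongrightarrow>
        indicator (cball p r) x * (divergence \<phi> x - ?N / r)"
      unfolding f_def by (intro always_eventually allI tendsto_intros) (metis cutoff_tendsto ind)
    show "AE x in lebesgue. norm (f n x * (divergence \<phi> x - ?N / r)) \<le> M * indicator ?K x" for n
    proof (intro always_eventually allI)
      fix x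
      show "norm (f n x * (divergence \<phi> x - ?N / r)) \<le> M * indicator ?K x"
      proof (cases "x \<in> ?K")
        case True
        have "\<bar>f n x\<bar> * \<bar>divergence \<phi> x - ?N / r\<bar> \<le> 1 * M"
          using cutoff_bounds M[OF True] by (intro mult_mono) (auto simp: f_def)
        with True show ?thesis by (simp add: abs_mult)
      qed (simp add: f_supp)
    qed
  qed
  then have "(\<integral>x. indicator (cball p r) x * (divergence \<phi> x - ?N / r) \<partial>lebesgue) \<le> 0"
    by (rule LIMSEQ_le_const2) (use le0 in blast)
  moreover show int: "integrable lebesgue (\<lambda>x. indicator (cball p r) x * divergence \<phi> x)"
  proof (rule integrable_bounded_support[of _ "M + ?N / r" p r])
    show "(\<lambda>x. indicator (cball p r) x * divergence \<phi> x) \<in> borel_measurable lebesgue"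
      by (intro borel_measurable_times borel_measurable_indicator lebesgue_measurable_continuous cdiv) auto
    have "\<bar>divergence \<phi> x\<bar> \<le> M + ?N / r" if "x \<in> cball p r" for x
    proof -
      have "r \<le> sqrt (r\<^sup>2 + 1)" using r by (simp add: real_le_rsqrt)
      then have "x \<in> ?K" using that by simp
      have "\<bar>divergence \<phi> x\<bar> \<le> \<bar>divergence \<phi> x - ?N / r\<bar> + \<bar>?N / r\<bar>" by linarith
      with M[OF \<open>x \<in> ?K\<close>] show ?thesis using r by simp
    qed
    then show "AE x in lebesgue. \<bar>indicator (cball p r) x * divergence \<phi> x\<bar> \<le> (M + ?N / r) * indicator (cball p r) x"
      by (intro always_eventually) (auto simp: indicator_def)
  qed
  moreover have "integrable lebesgue (\<lambda>x. ?N / r * indicat_real (cball p r) x)"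
    by (rule integrable_indicator_cball)
  ultimately show "(\<integral>x. indicator (cball p r) x * divergence \<phi> x \<partial>lebesgue)
      \<le> ?N / r * measure lebesgue (cball p r)"
    by (simp add: right_diff_distrib mult.commute)
qed

lemma total_variation_ball_le:
  fixes p :: "'a::euclidean_space"
  assumes "open \<Omega>" "cball p r \<subseteq> \<Omega>" "0 < r" "0 \<le> c"
  shows "total_variation \<Omega> (\<lambda>x. c * indicator (cball p r) x)
      \<le> ereal (c * (real DIM('a) / r * measure lebesgue (cball p r)))"
  unfolding total_variation_def
proof (rule SUP_least, clarify)
  fix \<phi> :: "'a \<Rightarrow> 'a"
  assume \<phi>: "C_k 1 \<phi>" "\<forall>x. norm (\<phi> x) \<le> 1"
  have "(\<integral>x. c * indicator (cball p r) x * divergence \<phi> x \<partial>lebesgue_on \<Omega>)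
      = (\<integral>x. c * (indicator (cball p r) x * divergence \<phi> x) \<partial>lebesgue)"
    using assms(1,2)
    by (subst integral_restrict_space, simp, intro Bochner_Integration.integral_cong)
       (auto simp: indicator_def)
  also have "\<dots> = c * (\<integral>x. indicator (cball p r) x * divergence \<phi> x \<partial>lebesgue)"
    by simp
  also have "\<dots> \<le> c * (real DIM('a) / r * measure lebesgue (cball p r))"
    using integral_divergence_ball_le(1)[of \<phi> r p] \<phi> assms by (intro mult_left_mono) auto
  finally show "ereal (\<integral>x. c * indicator (cball p r) x * divergence \<phi> x \<partial>lebesgue_on \<Omega>)
      \<le> ereal (c * (real DIM('a) / r * measure lebesgue (cball p r)))"
    by simp
qed

section \<open>The boundary trace of functions vanishing near the boundary\<close>

text \<open>An interior corkscrew condition, needed to keep the density of \<Omega> at a boundary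
  point away from 0. Differentiability of \<gamma> at the projection of x alone gives at most linear
  growth there, so a ball around x + (r / 2) e with radius a small multiple of r stays above the
  graph.\<close>

lemma smooth_bounded_domain_interior_balls:
  fixes \<Omega> :: "'a::euclidean_space set"
  assumes "smooth_bounded_domain \<Omega>" "x \<in> frontier \<Omega>"
  obtains \<kappa> r\<^sub>0 where "0 < \<kappa>" "0 < r\<^sub>0" "\<And>r. 0 < r \<Longrightarrow> r < r\<^sub>0 \<Longrightarrow> \<exists>y. ball y (\<kappa> * r) \<subseteq> \<Omega> \<inter> ball x r"
proof -
  obtain r\<^sub>1 e \<gamma> where r1: "r\<^sub>1 > 0" and e: "norm e = 1" and \<gamma>: "C_infinity (\<gamma> :: 'a \<Rightarrow> real)"
    and graph: "\<Omega> \<inter> ball x r\<^sub>1 = {w \<in> ball x r\<^sub>1. w \<bullet> e > \<gamma> (w - (w \<bullet> e) *\<^sub>R e)}"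
    using assms unfolding smooth_bounded_domain_def by meson
  have C1: "C_k 1 \<gamma>" using \<gamma> by (simp add: C_infinity_def)
  define \<pi> where "\<pi> = (\<lambda>w. w - (w \<bullet> e) *\<^sub>R e)"
  define \<gamma>' where "\<gamma>' = frechet_derivative \<gamma> (at (\<pi> x))"
  have "(\<gamma> has_derivative \<gamma>') (at (\<pi> x))"
    unfolding \<gamma>'_def by (rule C_k_1_D(1)[OF C1])
  then have bl: "bounded_linear \<gamma>'" and "\<forall>e>0. \<exists>d>0. \<forall>y. norm (y - \<pi> x) < d \<longrightarrow>
      norm (\<gamma> y - \<gamma> (\<pi> x) - \<gamma>' (y - \<pi> x)) \<le> e * norm (y - \<pi> x)"
    unfolding has_derivative_at_alt by auto
  then obtain \<delta> where \<delta>: "\<delta> > 0"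
    "\<And>y. norm (y - \<pi> x) < \<delta> \<Longrightarrow> norm (\<gamma> y - \<gamma> (\<pi> x) - \<gamma>' (y - \<pi> x)) \<le> 1 * norm (y - \<pi> x)"
    by (metis zero_less_one)
  obtain K where K: "\<And>h. norm (\<gamma>' h) \<le> norm h * K" "0 < K"
    using bounded_linear.pos_bounded[OF bl] by blast
  define L where "L = K + 1"
  have L: "L > 0" using K by (simp add: L_def)
  have lip: "\<gamma> y \<le> \<gamma> (\<pi> x) + L * norm (y - \<pi> x)" if "norm (y - \<pi> x) < \<delta>" for y
    using \<delta>(2)[OF that] K(1)[of "y - \<pi> x"] by (simp add: L_def algebra_simps abs_le_iff)
  \<comment> \<open>If x lay strictly below the graph, so would a neighbourhood of x, which would
    then miss \<Omega> although x is in its closure.\<close>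
  have above: "\<gamma> (\<pi> x) \<le> x \<bullet> e"
  proof (rule ccontr)
    assume "\<not> ?thesis"
    then have "x \<in> {w. w \<bullet> e < \<gamma> (\<pi> w)}" by simp
    moreover have "open {w. w \<bullet> e < \<gamma> (\<pi> w)}"
      unfolding \<pi>_def
      by (intro open_Collect_less continuous_intros continuous_on_compose2[OF C_k_1_D(3)[OF C1]]) auto
    ultimately obtain s where s: "s > 0" "ball x s \<subseteq> {w. w \<bullet> e < \<gamma> (\<pi> w)}"
      by (meson open_contains_ball)
    have "\<Omega> \<inter> ball x (min s r\<^sub>1) = {}"
    proof (rule ccontr)
      assume "\<Omega> \<inter> ball x (min s r\<^sub>1) \<noteq> {}"
      then obtain w where w: "w \<in> \<Omega>" "dist x w < s" "dist x w < r\<^sub>1" by auto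
      then have "w \<in> \<Omega> \<inter> ball x r\<^sub>1" by simp
      then have "w \<bullet> e > \<gamma> (\<pi> w)" unfolding graph \<pi>_def by simp
      with s(2) w(2) show False by force
    qed
    moreover have "x \<in> closure \<Omega>" using assms(2) by (simp add: frontier_def)
    ultimately show False
      using s(1) r1 by (metis Int_commute centre_in_ball disjoint_iff min_less_iff_conj open_Int_closure_eq_empty open_ball)
  qed
  \<comment> \<open>A displacement below \<kappa> r lowers the height by at most \<kappa> r and
    moves the projection by at most 2 \<kappa> r, which raises the graph by at most 2 L \<kappa> r.
    The sum must stay below the height r / 2 of the centre; \<kappa> \<le> 1 / 4 keeps the small
    ball inside \<open>ball x r\<close>.\<close>
  define \<kappa> where "\<kappa> = 1 / (4 * (1 + L))"
  have \<kappa>: "0 < \<kappa>" "\<kappa> \<le> 1 / 4" "\<kappa> * (1 + 2 * L) < 1 / 2"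
    using L by (auto simp: \<kappa>_def field_simps)
  show ?thesis
  proof (rule that[OF \<kappa>(1)])
    show "0 < min r\<^sub>1 \<delta>" using r1 \<delta>(1) by simp
    fix r assume r: "0 < r" "r < min r\<^sub>1 \<delta>"
    have "ball (x + (r / 2) *\<^sub>R e) (\<kappa> * r) \<subseteq> \<Omega> \<inter> ball x r"
    proof
      fix w assume w: "w \<in> ball (x + (r / 2) *\<^sub>R e) (\<kappa> * r)"
      define v where "v = w - (x + (r / 2) *\<^sub>R e)"
      have v: "norm v < \<kappa> * r"
        using w by (simp add: v_def dist_norm norm_minus_commute)
      have \<kappa>r: "\<kappa> * r \<le> r / 4" using \<kappa>(2) r(1) by (simp add: field_simps)
      have w_eq: "w = x + (r / 2) *\<^sub>R e + v" by (simp add: v_def)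
      have "norm ((r / 2) *\<^sub>R e + v) \<le> r / 2 + norm v"
        using norm_triangle_ineq[of "(r / 2) *\<^sub>R e" v] e r(1) by simp
      then have "norm (w - x) < r"
        using v \<kappa>r r(1) unfolding w_eq add.assoc add_diff_cancel_left' by linarith
      then have inball: "w \<in> ball x r"
        by (simp add: dist_norm norm_minus_commute)
      have ve: "\<bar>v \<bullet> e\<bar> \<le> norm v"
        using Cauchy_Schwarz_ineq2[of v e] e by simp
      have ee: "e \<bullet> e = 1" using e by (simp add: norm_eq_1)
      have "\<pi> w - \<pi> x = v - (v \<bullet> e) *\<^sub>R e"
        unfolding w_eq \<pi>_def by (simp add: inner_add_left ee algebra_simps)
      then have "norm (\<pi> w - \<pi> x) \<le> norm v + \<bar>v \<bullet> e\<bar>"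
        using norm_triangle_ineq4[of v "(v \<bullet> e) *\<^sub>R e"] e by simp
      then have pw: "norm (\<pi> w - \<pi> x) < 2 * (\<kappa> * r)"
        using ve v by linarith
      then have "norm (\<pi> w - \<pi> x) < \<delta>" using \<kappa>r r by linarith
      from lip[OF this] have "\<gamma> (\<pi> w) \<le> \<gamma> (\<pi> x) + L * (2 * (\<kappa> * r))"
        using mult_left_mono[OF less_imp_le[OF pw], of L] L by linarith
      also have "\<dots> \<le> x \<bullet> e + L * (2 * (\<kappa> * r))" using above by simp
      also have "\<dots> < x \<bullet> e + r / 2 - \<kappa> * r"
        using mult_strict_right_mono[OF \<kappa>(3) r(1)] by (simp add: algebra_simps)
      also have "\<dots> \<le> w \<bullet> e"
        unfolding w_eq using ve v by (simp add: inner_add_left ee)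
      finally have "w \<in> {w \<in> ball x r\<^sub>1. w \<bullet> e > \<gamma> (w - (w \<bullet> e) *\<^sub>R e)}"
        using inball r unfolding \<pi>_def by simp
      then show "w \<in> \<Omega> \<inter> ball x r"
        using inball unfolding graph[symmetric] by simp
    qed
    then show "\<exists>y. ball y (\<kappa> * r) \<subseteq> \<Omega> \<inter> ball x r" by blast
  qed
qed

text \<open>That 0 satisfies the limit condition is clear; the description also demands that no
  other c does. Near x the quotient for c equals |c| times the density of \<Omega>, and the interior
  balls bound that density below.\<close>

lemma bv_trace_eq_0:
  fixes \<Omega> :: "'a::euclidean_space set"
  assumes \<Omega>: "smooth_bounded_domain \<Omega>" and x: "x \<in> frontier \<Omega>"
    and "0 < \<delta>" and u: "\<And>y. y \<in> \<Omega> \<inter> ball x \<delta> \<Longrightarrow> u y = 0"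
  shows "bv_trace \<Omega> u x = 0"
proof -
  obtain \<kappa> r\<^sub>0 where \<kappa>: "0 < \<kappa>" "0 < r\<^sub>0" "\<And>r. 0 < r \<Longrightarrow> r < r\<^sub>0 \<Longrightarrow> \<exists>y. ball y (\<kappa> * r) \<subseteq> \<Omega> \<inter> ball x r"
    using smooth_bounded_domain_interior_balls[OF \<Omega> x] by metis
  have op: "open \<Omega>" using \<Omega> by (simp add: smooth_bounded_domain_def)
  define Q where "Q = (\<lambda>c r. (\<integral>y. \<bar>u y - c\<bar> \<partial>lebesgue_on (\<Omega> \<inter> ball x r)) / r ^ DIM('a))"
  have Q: "Q c r = \<bar>c\<bar> * measure lebesgue (\<Omega> \<inter> ball x r) / r ^ DIM('a)" if "0 < r" "r < \<delta>" for c r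
  proof -
    have "(\<integral>y. \<bar>u y - c\<bar> \<partial>lebesgue_on (\<Omega> \<inter> ball x r)) = (\<integral>y. \<bar>c\<bar> \<partial>lebesgue_on (\<Omega> \<inter> ball x r))"
      using u that by (intro Bochner_Integration.integral_cong) auto
    also have "\<dots> = \<bar>c\<bar> * measure lebesgue (\<Omega> \<inter> ball x r)"
      using op by (simp add: measure_restrict_space)
    finally show ?thesis by (simp add: Q_def)
  qed
  let ?V = "unit_ball_vol (real DIM('a)) * \<kappa> ^ DIM('a)"
  have V: "?V > 0" using \<kappa>(1) by simp
  have low: "\<bar>c\<bar> * ?V \<le> Q c r" if r: "0 < r" "r < \<delta>" "r < r\<^sub>0" for c r
  proof -
    obtain y where y: "ball y (\<kappa> * r) \<subseteq> \<Omega> \<inter> ball x r" using \<kappa>(3) r by blast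
    have "?V * r ^ DIM('a) = measure lebesgue (ball y (\<kappa> * r))"
      using \<kappa>(1) r(1) by (simp add: content_ball power_mult_distrib)
    also have "\<dots> \<le> measure lebesgue (\<Omega> \<inter> ball x r)"
      using op by (intro measure_mono_fmeasurable y) (auto intro!: bounded_set_imp_lmeasurable bounded_Int lmeasurable_open)
    finally have "\<bar>c\<bar> * (?V * r ^ DIM('a)) \<le> \<bar>c\<bar> * measure lebesgue (\<Omega> \<inter> ball x r)"
      by (intro mult_left_mono) auto
    then show ?thesis
      using r(1) by (simp add: Q[OF r(1,2)] field_simps)
  qed
  have "(THE c. (Q c \<longlongrightarrow> 0) (at_right 0)) = 0"
  proof (rule the_equality)
    have "\<forall>\<^sub>F r in at_right 0. Q 0 r = 0"
      using Q[of _ 0] \<open>0 < \<delta>\<close> by (intro eventually_at_rightI[of 0 \<delta>]) auto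
    then show "(Q 0 \<longlongrightarrow> 0) (at_right 0)" by (rule tendsto_eventually)
    fix c assume c: "(Q c \<longlongrightarrow> 0) (at_right 0)"
    have "\<bar>c\<bar> * ?V \<le> 0"
      by (rule tendsto_lowerbound[OF c], rule eventually_at_rightI[of 0 "min \<delta> r\<^sub>0"])
        (use low \<open>0 < \<delta>\<close> \<kappa>(2) in auto)
    with V show "c = 0"
      by (metis abs_le_zero_iff mult_le_cancel_right mult_zero_left not_less)
  qed
  then show ?thesis
    unfolding bv_trace_def Q_def by simp
qed

text \<open>The trace is 0 at every frontier point, so the boundary integral is 0 whatever the
  Hausdorff measure is.\<close>

lemma BV_norm_eq_total_variation:
  fixes \<Omega> :: "'a::euclidean_space set"
  assumes \<Omega>: "smooth_bounded_domain \<Omega>" and K: "compact K" "K \<subseteq> \<Omega>"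
    and u: "\<And>x. x \<in> \<Omega> - K \<Longrightarrow> u x = 0"
  shows "BV_norm \<Omega> u = total_variation \<Omega> u"
proof -
  have op: "open \<Omega>" using \<Omega> by (simp add: smooth_bounded_domain_def)
  have trace: "bv_trace \<Omega> u x = 0" if x: "x \<in> frontier \<Omega>" for x
  proof -
    have "x \<notin> \<Omega>" using x op by (simp add: frontier_def interior_open)
    then have "x \<in> - K" "open (- K)"
      using K by (auto simp: compact_imp_closed open_Compl)
    then obtain \<delta> where "\<delta> > 0" "ball x \<delta> \<subseteq> - K"
      by (meson open_contains_ball)
    then show ?thesis
      using u by (intro bv_trace_eq_0[OF \<Omega> x]) auto
  qed
  have "(\<lambda>x. ennreal \<bar>bv_trace \<Omega> u x\<bar> * indicator (frontier \<Omega>) x) = (\<lambda>_. 0)"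
  proof
    fix x
    show "ennreal \<bar>bv_trace \<Omega> u x\<bar> * indicator (frontier \<Omega>) x = 0"
      using trace[of x] by (cases "x \<in> frontier \<Omega>") auto
  qed
  then show ?thesis
    by (simp add: BV_norm_def zero_ennreal.rep_eq)
qed

lemma total_variation_le_BV_norm: "total_variation \<Omega> u \<le> BV_norm \<Omega> u"
proof -
  have "total_variation \<Omega> u + 0 \<le> BV_norm \<Omega> u"
    unfolding BV_norm_def by (intro add_left_mono) simp
  then show ?thesis by simp
qed

section \<open>Clarke derivatives of the concave part\<close>

lemma set_integrable_mono:
  fixes k :: "real \<Rightarrow> real"
  assumes "mono k"
  shows "set_integrable lborel {a..b} k"
proof (rule set_integrable_bound[where f = "\<lambda>_. \<bar>k a\<bar> + \<bar>k b\<bar>"])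
  show "set_borel_measurable lborel {a..b} k"
    using borel_measurable_mono[OF assms] by (simp add: set_borel_measurable_def)
  show "AE x in lborel. x \<in> {a..b} \<longrightarrow> norm (k x) \<le> norm (\<bar>k a\<bar> + \<bar>k b\<bar>)"
  proof (intro always_eventually allI impI)
    fix x assume "x \<in> {a..b}"
    then have "k a \<le> k x" "k x \<le> k b" using assms by (auto simp: mono_def)
    then show "norm (k x) \<le> norm (\<bar>k a\<bar> + \<bar>k b\<bar>)" by auto
  qed
  show "set_integrable lborel {a..b} (\<lambda>_. \<bar>k a\<bar> + \<bar>k b\<bar>)"
    unfolding set_integrable_def
    by (intro integrable_scaleR_left integrable_real_indicator) (auto simp: emeasure_lborel_Icc_eq)
qed

lemma interval_integrable_mono:
  fixes k :: "real \<Rightarrow> real"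
  assumes "mono k"
  shows "interval_lebesgue_integrable lborel (ereal a) (ereal b) k"
  unfolding interval_lebesgue_integrable_def
  using set_integrable_subset[OF set_integrable_mono[OF assms, of a b], of "{a<..<b}"]
    set_integrable_subset[OF set_integrable_mono[OF assms, of b a], of "{b<..<a}"]
  by (auto simp: einterval_eq less_imp_le subset_iff)

text \<open>The primitive of a monotone function is convex, and k x is a subgradient at x even where
  k jumps. This covers \<open>F\<close> with \<open>sgn\<close> and \<open>G\<close> with its
  discontinuous integrand.\<close>

lemma interval_integral_mono_subgradient:
  fixes k :: "real \<Rightarrow> real"
  assumes k: "mono k"
  shows "(LBINT t=0..x. k t) + k x * (y - x) \<le> (LBINT t=0..y. k t)"
proof -
  note int = set_integrable_mono[OF k]
  have const: "set_integrable lborel {a..b} (\<lambda>_. k x)" for a b :: real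
    by (rule set_integrable_mono) (simp add: mono_def)
  have split: "(LBINT t=0..x. k t) + (LBINT t=x..y. k t) = (LBINT t=0..y. k t)"
    using interval_integral_sum[where a = "ereal 0" and b = "ereal x" and c = "ereal y" and f = k]
      interval_integrable_mono[OF k, of "min 0 (min x y)" "max 0 (max x y)"]
    by (simp add: zero_ereal_def)
  have "k x * (y - x) \<le> (LBINT t=x..y. k t)"
  proof (cases "x \<le> y")
    case True
    have "k x * (y - x) = (LBINT t:{x..y}. k x)"
      using True by (simp add: set_lebesgue_integral_def mult.commute)
    also have "\<dots> \<le> (LBINT t:{x..y}. k t)"
      using k by (intro set_integral_mono const int) (auto simp: mono_def)
    finally show ?thesis using True by (simp add: interval_integral_Icc)
  next
    case False
    have "(LBINT t:{y..x}. k t) \<le> (LBINT t:{y..x}. k x)"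
      using k False by (intro set_integral_mono const int) (auto simp: mono_def)
    also have "\<dots> = k x * (x - y)"
      using False by (simp add: set_lebesgue_integral_def mult.commute)
    finally have "k x * (y - x) \<le> - (LBINT t:{y..x}. k t)"
      by (simp add: algebra_simps)
    also have "\<dots> = (LBINT t=x..y. k t)"
      using False by (subst interval_integral_endpoints_reverse) (simp add: interval_integral_Icc)
    finally show ?thesis .
  qed
  with split show ?thesis by linarith
qed

lemma borel_measurable_interval_integral_mono:
  fixes k :: "real \<Rightarrow> real"
  assumes k: "mono k"
  shows "(\<lambda>x::real. LBINT t=0..x. k t) \<in> borel_measurable borel"
proof -
  let ?J = "\<lambda>x::real. LBINT t=0..x. k t"
  have "convex_on UNIV ?J"
  proof (rule convex_onI)
    fix t x y :: real assume t: "0 < t" "t < 1"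
    define m where "m = (1 - t) *\<^sub>R x + t *\<^sub>R y"
    \<comment> \<open>The subgradient inequalities at the intermediate point m are averaged; their
      linear terms cancel. Convexity then gives continuity and hence measurability.\<close>
    have "?J m = (1 - t) * (?J m + k m * (x - m)) + t * (?J m + k m * (y - m))"
      by (simp add: m_def algebra_simps)
    also have "\<dots> \<le> (1 - t) * ?J x + t * ?J y"
      using t by (intro add_mono mult_left_mono interval_integral_mono_subgradient[OF k]) auto
    finally show "?J ((1 - t) *\<^sub>R x + t *\<^sub>R y) \<le> (1 - t) * ?J x + t * ?J y"
      by (simp add: m_def)
  qed simp
  then have "continuous_on UNIV ?J"
    by (intro convex_on_continuous) auto
  then show ?thesis by (rule borel_measurable_continuous_onI)
qed

section \<open>The primitives \<open>F\<close> and \<open>G\<close> and their subgradients\<close>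

lemma F_0: "F 0 = 0"
  by (simp add: F_def flip: zero_ereal_def)

lemma F_eq_abs: "F s = \<bar>s\<bar>"
proof -
  have m: "mono (sgn :: real \<Rightarrow> real)"
    by (auto simp: mono_def sgn_if)
  have sub: "F x + sgn x * (y - x) \<le> F y" for x y
    unfolding F_def by (rule interval_integral_mono_subgradient[OF m])
  have "F s \<le> \<bar>s\<bar>"
    using sub[of s 0] by (simp add: F_0 abs_sgn mult.commute)
  moreover have "\<bar>s\<bar> - \<epsilon> \<le> F s" if "\<epsilon> > 0" for \<epsilon>
  proof -
    \<comment> \<open>Since \<open>sgn 0 = 0\<close>, the subgradient inequality at 0 only yields F
      \<ge> 0. A base point on the side of s and within \<epsilon> / 2 of 0 has the right slope and
      loses at most \<epsilon>.\<close>
    define x where "x = sgn s * min (\<epsilon> / 2) \<bar>s\<bar>"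
    have "0 + sgn x * (s - x) \<le> F s"
      using sub[of x s] sub[of 0 x] by (simp add: F_0)
    then show ?thesis using that by (auto simp: x_def F_0 sgn_if min_def split: if_splits)
  qed
  ultimately show ?thesis
    by (meson antisym field_le_epsilon diff_le_eq)
qed

definition G_kernel :: "real \<Rightarrow> real \<Rightarrow> real \<Rightarrow> real" where
  "G_kernel q a t = heaviside (\<bar>t\<bar> - a) * (\<bar>t\<bar> powr (q - 2) * t)"

context
  fixes q a :: real
  assumes q: "1 < q" and a: "0 < a"
begin

lemma G_kernel_eq: "G_kernel q a t = (if \<bar>t\<bar> < a then 0 else sgn t * \<bar>t\<bar> powr (q - 1))"
proof -
  have "\<bar>t\<bar> powr (q - 2) * t = sgn t * \<bar>t\<bar> powr (q - 1)"
  proof (cases "t = 0")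
    case False
    then have "\<bar>t\<bar> powr (q - 1) = \<bar>t\<bar> powr (q - 2) * \<bar>t\<bar>"
      using powr_add[of "\<bar>t\<bar>" "q - 2" 1] by simp
    then show ?thesis using False by (auto simp: sgn_if abs_if)
  qed simp
  then show ?thesis by (simp add: G_kernel_def heaviside_def)
qed

text \<open>For q > 1 the signed power increases, and setting it to 0 below the threshold creates
  only upward jumps at a and -a. This is the source of the convexity of \<open>G\<close>.\<close>

lemma mono_G_kernel: "mono (G_kernel q a)"
proof (rule monoI)
  fix s t :: real assume st: "s \<le> t"
  consider "0 \<le> s" | "t \<le> 0" | "s < 0" "0 < t" using st by linarith
  then show "G_kernel q a s \<le> G_kernel q a t"
  proof cases
    case 1
    then show ?thesis using st a q powr_mono2[of "q - 1" s t] by (auto simp: G_kernel_eq sgn_if)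
  next
    case 2
    then show ?thesis using st a q powr_mono2[of "q - 1" "- t" "- s"] by (auto simp: G_kernel_eq sgn_if)
  next
    case 3
    then show ?thesis
      using order_trans[of "- ((- s) powr (q - 1))" 0 "t powr (q - 1)"] by (auto simp: G_kernel_eq)
  qed
qed

lemma G_eq: "G q a s = (LBINT t=0..s. G_kernel q a t)"
  by (simp add: G_def G_kernel_def)

lemma G_subgradient: "G q a x + G_kernel q a x * (y - x) \<le> G q a y"
  unfolding G_eq by (rule interval_integral_mono_subgradient[OF mono_G_kernel])

lemma G_0: "G q a 0 = 0"
  by (simp add: G_eq flip: zero_ereal_def)

lemma G_nonneg: "0 \<le> G q a s"
  using G_subgradient[of 0 s] a by (simp add: G_0 G_kernel_eq)

lemma G_le: "G q a s \<le> \<bar>s\<bar> powr q"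
proof -
  have "G q a s \<le> G_kernel q a s * s"
    using G_subgradient[of s 0] by (simp add: G_0)
  also have "\<dots> \<le> \<bar>s\<bar> powr q"
  proof (cases "s = 0")
    case False
    have "\<bar>s\<bar> powr q = \<bar>s\<bar> powr (q - 1) * \<bar>s\<bar>"
      using False powr_add[of "\<bar>s\<bar>" "q - 1" 1] by simp
    then show ?thesis by (auto simp: G_kernel_eq sgn_if)
  qed (simp add: G_kernel_eq)
  finally show ?thesis .
qed

lemma measurable_G: "G q a \<in> borel_measurable borel"
  using borel_measurable_interval_integral_mono[OF mono_G_kernel] by (simp add: G_eq [abs_def])

section \<open>The space L^q and Clarke derivatives on it\<close>

lemma Lq_lincomb:
  assumes "u \<in> Lq \<Omega> q" "v \<in> Lq \<Omega> q"
  shows "(\<lambda>x. u x + t * v x) \<in> Lq \<Omega> q"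
proof -
  have [measurable]: "u \<in> borel_measurable (lebesgue_on \<Omega>)" "v \<in> borel_measurable (lebesgue_on \<Omega>)"
    using assms by (auto simp: Lq_def)
  have "integrable (lebesgue_on \<Omega>) (\<lambda>x. \<bar>u x + t * v x\<bar> powr q)"
  proof (rule Bochner_Integration.integrable_bound)
    show "integrable (lebesgue_on \<Omega>) (\<lambda>x. 2 powr q * \<bar>u x\<bar> powr q + (2 * \<bar>t\<bar>) powr q * \<bar>v x\<bar> powr q)"
      using assms by (auto simp: Lq_def)
    show "AE x in lebesgue_on \<Omega>. norm (\<bar>u x + t * v x\<bar> powr q)
        \<le> norm (2 powr q * \<bar>u x\<bar> powr q + (2 * \<bar>t\<bar>) powr q * \<bar>v x\<bar> powr q)"
    proof (intro always_eventually allI)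
      fix x
      have "\<bar>u x + t * v x\<bar> \<le> max (2 * \<bar>u x\<bar>) (2 * \<bar>t\<bar> * \<bar>v x\<bar>)"
        using abs_triangle_ineq[of "u x" "t * v x"] by (simp add: abs_mult max_def)
      then have "\<bar>u x + t * v x\<bar> powr q \<le> (max (2 * \<bar>u x\<bar>) (2 * \<bar>t\<bar> * \<bar>v x\<bar>)) powr q"
        using q by (intro powr_mono2) auto
      also have "\<dots> \<le> (2 * \<bar>u x\<bar>) powr q + (2 * \<bar>t\<bar> * \<bar>v x\<bar>) powr q"
        by (simp add: max_def)
      also have "\<dots> = 2 powr q * \<bar>u x\<bar> powr q + (2 * \<bar>t\<bar>) powr q * \<bar>v x\<bar> powr q"
        by (simp add: powr_mult)
      finally show "norm (\<bar>u x + t * v x\<bar> powr q)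
        \<le> norm (2 powr q * \<bar>u x\<bar> powr q + (2 * \<bar>t\<bar>) powr q * \<bar>v x\<bar> powr q)" by simp
    qed
  qed measurable
  then show ?thesis by (simp add: Lq_def)
qed

lemma Lq_integrable:
  assumes "bounded \<Omega>" "open \<Omega>" "u \<in> Lq \<Omega> q"
  shows "integrable (lebesgue_on \<Omega>) u" "integrable (lebesgue_on \<Omega>) (\<lambda>x. G q a (u x))"
proof -
  have m[measurable]: "u \<in> borel_measurable (lebesgue_on \<Omega>)"
    and i: "integrable (lebesgue_on \<Omega>) (\<lambda>x. \<bar>u x\<bar> powr q)"
    using assms by (auto simp: Lq_def)
  have "finite_measure (lebesgue_on \<Omega>)"
    using assms by (intro finite_measure_lebesgue_on) (simp add: lmeasurable_open)
  then have one: "integrable (lebesgue_on \<Omega>) (\<lambda>x. 1 + \<bar>u x\<bar> powr q)"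
    using i by (intro Bochner_Integration.integrable_add finite_measure.integrable_const)
  show "integrable (lebesgue_on \<Omega>) u"
  proof (rule Bochner_Integration.integrable_bound[OF one m], intro always_eventually allI)
    fix x
    have "\<bar>u x\<bar> \<le> 1 + \<bar>u x\<bar> powr q"
    proof (cases "\<bar>u x\<bar> \<le> 1")
      case False
      then show ?thesis using powr_mono[of 1 q "\<bar>u x\<bar>"] q by simp
    qed (simp add: add_increasing2)
    then show "norm (u x) \<le> norm (1 + \<bar>u x\<bar> powr q)" by simp
  qed
  show "integrable (lebesgue_on \<Omega>) (\<lambda>x. G q a (u x))"
    by (rule Bochner_Integration.integrable_bound[OF i])
      (use measurable_G G_nonneg G_le in \<open>auto intro!: measurable_compose[OF m]\<close>)
qed

text \<open>The limes superior is bounded below along \<open>w = u - t h\<close>, where the difference quotient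
  compares \<open>u\<close> with \<open>u - t h\<close>.\<close>

lemma clarke_derivative_ge:
  assumes u: "u \<in> Lq \<Omega> q" and h: "h \<in> Lq \<Omega> q"
    and C: "\<And>t. 0 < t \<Longrightarrow> C \<le> (f u - f (\<lambda>x. u x - t * h x)) / t"
  shows "ereal C \<le> clarke_derivative (Lq \<Omega> q) (Lq_norm \<Omega> q) f u h"
proof -
  let ?W = "inf (principal (Lq \<Omega> q)) (filtercomap (\<lambda>w. Lq_norm \<Omega> q (\<lambda>x. w x - u x)) (nhds 0))"
  let ?Q = "\<lambda>(w, t). ereal ((f (\<lambda>x. w x + t * h x) - f w) / t)"
  define \<omega> where "\<omega> = (\<lambda>t x. u x - t * h x)"
  have \<omega>_Lq: "\<omega> t \<in> Lq \<Omega> q" for t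
    using Lq_lincomb[OF u h, of "- t"] by (simp add: \<omega>_def)
  have nrm: "Lq_norm \<Omega> q (\<lambda>x. \<omega> t x - u x) = t * Lq_norm \<Omega> q h" if "0 < t" for t
  proof -
    have "(\<integral>x. \<bar>\<omega> t x - u x\<bar> powr q \<partial>lebesgue_on \<Omega>) = t powr q * (\<integral>x. \<bar>h x\<bar> powr q \<partial>lebesgue_on \<Omega>)"
      using that by (simp add: \<omega>_def abs_mult powr_mult)
    then show ?thesis
      using that q by (simp add: Lq_norm_def powr_mult powr_powr)
  qed
  have "((\<lambda>t. Lq_norm \<Omega> q (\<lambda>x. \<omega> t x - u x)) \<longlongrightarrow> 0) (at_right 0)"
  proof (rule Lim_transform_eventually)
    show "((\<lambda>t. t * Lq_norm \<Omega> q h) \<longlongrightarrow> 0) (at_right 0)"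
      by (intro tendsto_eq_intros) auto
    show "\<forall>\<^sub>F t in at_right 0. t * Lq_norm \<Omega> q h = Lq_norm \<Omega> q (\<lambda>x. \<omega> t x - u x)"
      using nrm by (intro eventually_at_rightI[of 0 1]) auto
  qed
  then have "filterlim (\<lambda>t. (\<omega> t, t)) (?W \<times>\<^sub>F at_right 0) (at_right 0)"
    using \<omega>_Lq by (intro filterlim_Pair filterlim_inf[THEN iffD2] conjI filterlim_ident)
      (auto simp: filterlim_principal filterlim_filtercomap_iff o_def)
  then have le: "filtermap (\<lambda>t. (\<omega> t, t)) (at_right 0) \<le> ?W \<times>\<^sub>F at_right 0"
    by (simp add: filterlim_def)
  have "ereal C \<le> Limsup (at_right 0) (\<lambda>t. ?Q (\<omega> t, t))"
  proof (rule le_Limsup)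
    show "\<forall>\<^sub>F t in at_right 0. ereal C \<le> ?Q (\<omega> t, t)"
      using C by (intro eventually_at_rightI[of 0 1]) (auto simp: \<omega>_def)
  qed simp
  also have "\<dots> \<le> Limsup (filtermap (\<lambda>t. (\<omega> t, t)) (at_right 0)) ?Q"
    by (rule Limsup_filtermap_ge)
  also have "\<dots> \<le> Limsup (?W \<times>\<^sub>F at_right 0) ?Q"
    unfolding Limsup_def using le by (intro INF_superset_mono) (auto simp: le_filter_def)
  finally show ?thesis
    unfolding clarke_derivative_def .
qed

text \<open>The hypotheses make d x a subgradient of the convex function lam |s| + G(s) at u x
  almost everywhere; at u x = 0 every number in [-lam, lam] is one because G is nonnegative and
  vanishes at 0. Integrating the subgradient inequality between u and u - t h bounds the quotient
  required by \<open>clarke_derivative_ge\<close>.\<close>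

lemma clarke_derivative_\<Phi>_ge:
  assumes \<Omega>: "bounded \<Omega>" "open \<Omega>" and u: "u \<in> Lq \<Omega> q" and h: "h \<in> Lq \<Omega> q" and lam: "0 < lam"
    and dh: "integrable (lebesgue_on \<Omega>) (\<lambda>x. d x * h x)"
    and d_pos: "AE x in lebesgue_on \<Omega>. u x \<noteq> 0 \<longrightarrow> d x = lam * sgn (u x) + G_kernel q a (u x)"
    and d_zero: "AE x in lebesgue_on \<Omega>. u x = 0 \<longrightarrow> \<bar>d x\<bar> \<le> lam"
  shows "ereal (- (\<integral>x. d x * h x \<partial>lebesgue_on \<Omega>)) \<le>
    clarke_derivative (Lq \<Omega> q) (Lq_norm \<Omega> q) (\<Phi> \<Omega> q lam a) u h"
proof (rule clarke_derivative_ge[OF u h])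
  fix t :: real assume t: "0 < t"
  define w where "w = (\<lambda>x. u x - t * h x)"
  have w: "w \<in> Lq \<Omega> q"
    using Lq_lincomb[OF u h, of "- t"] by (simp add: w_def)
  note int = Lq_integrable[OF \<Omega> u] Lq_integrable[OF \<Omega> w]
  have i1: "integrable (lebesgue_on \<Omega>) (\<lambda>x. lam * (\<bar>w x\<bar> - \<bar>u x\<bar>) + (G q a (w x) - G q a (u x)))"
    using int by (intro Bochner_Integration.integrable_add integrable_mult_right Bochner_Integration.integrable_diff integrable_abs)
  have "(\<integral>x. - (t * (d x * h x)) \<partial>lebesgue_on \<Omega>)
    \<le> (\<integral>x. lam * (\<bar>w x\<bar> - \<bar>u x\<bar>) + (G q a (w x) - G q a (u x)) \<partial>lebesgue_on \<Omega>)"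
  proof (rule integral_mono_AE[OF _ i1])
    show "AE x in lebesgue_on \<Omega>. - (t * (d x * h x)) \<le>
        lam * (\<bar>w x\<bar> - \<bar>u x\<bar>) + (G q a (w x) - G q a (u x))"
      using d_pos d_zero
    proof eventually_elim
      case (elim x)
      show ?case
      proof (cases "u x = 0")
        case True
        then have "\<bar>d x\<bar> * (t * \<bar>h x\<bar>) \<le> lam * (t * \<bar>h x\<bar>)"
          using elim t by (intro mult_right_mono) auto
        then have "\<bar>t * (d x * h x)\<bar> \<le> lam * \<bar>t * h x\<bar>"
          using t by (simp add: abs_mult ac_simps)
        then have "- (t * (d x * h x)) \<le> lam * \<bar>w x\<bar>"
          using True by (simp add: w_def abs_le_iff)
        then show ?thesis
          using True G_nonneg[of "w x"] by (simp add: G_0)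
      next
        case False
        have "\<bar>u x\<bar> + sgn (u x) * (w x - u x) \<le> \<bar>w x\<bar>"
          using False by (auto simp: sgn_if)
        then have "lam * (sgn (u x) * (w x - u x)) \<le> lam * (\<bar>w x\<bar> - \<bar>u x\<bar>)"
          using lam by (intro mult_left_mono) auto
        moreover have "G_kernel q a (u x) * (w x - u x) \<le> G q a (w x) - G q a (u x)"
          using G_subgradient[of "u x" "w x"] by simp
        ultimately show ?thesis
          using elim False by (simp add: w_def algebra_simps)
      qed
    qed
  qed (use dh in auto)
  moreover have "(\<integral>x. lam * (\<bar>w x\<bar> - \<bar>u x\<bar>) + (G q a (w x) - G q a (u x)) \<partial>lebesgue_on \<Omega>)
      = \<Phi> \<Omega> q lam a u - \<Phi> \<Omega> q lam a w"
    using int by (simp add: \<Phi>_def F_eq_abs integrable_abs algebra_simps)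
  ultimately show "- (\<integral>x. d x * h x \<partial>lebesgue_on \<Omega>) \<le> (\<Phi> \<Omega> q lam a u - \<Phi> \<Omega> q lam a (\<lambda>x. u x - t * h x)) / t"
    using t by (simp add: w_def field_simps)
qed

end

section \<open>Explicit solutions\<close>

text \<open>\<open>R_power\<close> is a flux balance: divergence N / r on the ball of radius r is
  compensated by density lam in the shell up to R, i.e. (N / r) r^N = lam (R^N - r^N).
  \<open>r_small\<close> says that the height c with c^(q-1) = N / r - lam exceeds a.\<close>

locale ball_solution =
  fixes \<Omega> :: "'a::euclidean_space set" and p :: 'a and r R lam q a :: real
  assumes dim: "2 \<le> DIM('a)" and smooth: "smooth_bounded_domain \<Omega>"
    and q: "1 < q" and a: "0 < a" and lam: "0 < lam" and r: "0 < r" and R: "0 < R"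
    and R_power: "R ^ DIM('a) = r ^ DIM('a) + real DIM('a) * r ^ (DIM('a) - 1) / lam"
    and subset: "cball p R \<subseteq> \<Omega>" and r_small: "a powr (q - 1) < real DIM('a) / r - lam"
begin

lemma N_pos: "0 < real DIM('a)"
  using dim by simp

text \<open>The divergence of \<open>\<psi> (\<bar>x\<bar>\<^sup>2) x\<close> is \<open>- lam\<close>; the constants make \<open>\<psi>\<close> equal to
  \<open>1 / r\<close> at \<open>r\<^sup>2\<close> and to \<open>0\<close> at \<open>R\<^sup>2\<close>.\<close>

definition \<psi> :: "real \<Rightarrow> real" where
  "\<psi> s = lam / real DIM('a) * (R ^ DIM('a) * s powr (- (real DIM('a) / 2)) - 1)"

definition \<psi>' :: "real \<Rightarrow> real" where
  "\<psi>' s = - (lam / 2 * (R ^ DIM('a) * s powr (- (real DIM('a) / 2) - 1)))"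

text \<open>Freezing the argument of \<open>\<psi>\<close> at r^2 and R^2 makes the profile 1 / r on
  the inner ball and 0 beyond R, and it keeps \<open>\<psi>\<close> away from its singularity at
  0.\<close>

definition clamp :: "real \<Rightarrow> real" where
  "clamp s = max (r\<^sup>2) (min (R\<^sup>2) s)"

definition g :: "real \<Rightarrow> real" where
  "g s = \<psi> (clamp s)"

definition g' :: "real \<Rightarrow> real" where
  "g' s = (if r\<^sup>2 < s \<and> s < R\<^sup>2 then \<psi>' s else 0)"

lemma r_less_R: "r < R"
proof -
  have "r ^ DIM('a) < R ^ DIM('a)"
    using R_power r lam N_pos by simp
  then show ?thesis using R by (simp add: power_less_imp_less_base)
qed

lemma r2_less_R2: "r\<^sup>2 < R\<^sup>2"
  using r_less_R r by (simp add: power_strict_mono)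

lemma powr_square: "0 < \<sigma> \<Longrightarrow> (\<sigma>\<^sup>2) powr (- (real DIM('a) / 2)) = 1 / \<sigma> ^ DIM('a)"
proof -
  assume "0 < \<sigma>"
  then have "(\<sigma>\<^sup>2) powr (- (real DIM('a) / 2)) = (\<sigma> powr 2) powr (- (real DIM('a) / 2))"
    by simp
  also have "\<dots> = \<sigma> powr (- real DIM('a))"
    unfolding powr_powr by simp
  also have "\<dots> = 1 / \<sigma> ^ DIM('a)"
    using \<open>0 < \<sigma>\<close> by (simp add: powr_minus_divide powr_realpow)
  finally show ?thesis .
qed

lemma \<psi>_square: "0 < \<sigma> \<Longrightarrow> \<psi> (\<sigma>\<^sup>2) = lam / real DIM('a) * (R ^ DIM('a) / \<sigma> ^ DIM('a) - 1)"
  by (simp add: \<psi>_def powr_square)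

lemma \<psi>_R: "\<psi> (R\<^sup>2) = 0"
  using \<psi>_square[OF R] R by simp

lemma \<psi>_r: "\<psi> (r\<^sup>2) = 1 / r"
proof -
  obtain m where m: "DIM('a) = Suc m"
    using dim by (cases "DIM('a)") auto
  have "R ^ DIM('a) / r ^ DIM('a) - 1 = real DIM('a) / (lam * r)"
    unfolding R_power unfolding m using r lam by (simp add: field_simps)
  then show ?thesis
    unfolding \<psi>_square[OF r] using r lam N_pos by (simp add: field_simps)
qed

lemma deriv_\<psi>: "0 < s \<Longrightarrow> (\<psi> has_real_derivative \<psi>' s) (at s)"
  unfolding \<psi>_def \<psi>'_def using N_pos
  by (auto intro!: derivative_eq_intros simp: field_simps)

lemma \<psi>_antimono: "0 < s \<Longrightarrow> s \<le> t \<Longrightarrow> \<psi> t \<le> \<psi> s"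
  unfolding \<psi>_def using lam R N_pos
  by (intro mult_left_mono diff_right_mono powr_mono2') auto

lemma \<psi>'_bound: "r\<^sup>2 \<le> s \<Longrightarrow> \<bar>\<psi>' s\<bar> \<le> \<bar>\<psi>' (r\<^sup>2)\<bar>"
proof -
  assume s: "r\<^sup>2 \<le> s"
  have "s powr (- (real DIM('a) / 2) - 1) \<le> (r\<^sup>2) powr (- (real DIM('a) / 2) - 1)"
    using s r by (intro powr_mono2') auto
  then show ?thesis
    unfolding \<psi>'_def using lam R by (simp add: abs_mult)
qed

lemma clamp_bounds: "r\<^sup>2 \<le> clamp s" "0 < clamp s"
proof -
  show "r\<^sup>2 \<le> clamp s" by (simp add: clamp_def)
  then show "0 < clamp s" using less_le_trans[OF zero_less_power[OF r]] by blast
qed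

sublocale radial_profile p g g' "R\<^sup>2" "\<bar>\<psi>' (r\<^sup>2)\<bar>" "{r\<^sup>2, R\<^sup>2}"
proof unfold_locales
  show "antimono g"
    unfolding g_def by (intro antimonoI \<psi>_antimono clamp_bounds) (auto simp: clamp_def)
  \<comment> \<open>The slope of \<open>\<psi>\<close> is steepest at r^2, and \<open>clamp\<close>
    is nonexpansive, so this Lipschitz constant passes to \<open>g\<close>.\<close>
  have lip: "\<bar>\<psi> s - \<psi> t\<bar> \<le> \<bar>\<psi>' (r\<^sup>2)\<bar> * \<bar>s - t\<bar>" if "r\<^sup>2 \<le> s" "r\<^sup>2 \<le> t" for s t
  proof -
    have "norm (\<psi> s - \<psi> t) \<le> \<bar>\<psi>' (r\<^sup>2)\<bar> * norm (s - t)"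
    proof (rule field_differentiable_bound[where S = "{r\<^sup>2..}" and f' = \<psi>'])
      fix x assume x: "x \<in> {r\<^sup>2..}"
      then have "0 < x" using less_le_trans[OF zero_less_power[OF r]] by auto
      then show "(\<psi> has_field_derivative \<psi>' x) (at x within {r\<^sup>2..})"
        by (rule has_field_derivative_at_within[OF deriv_\<psi>])
      show "norm (\<psi>' x) \<le> \<bar>\<psi>' (r\<^sup>2)\<bar>" using x \<psi>'_bound by simp
    qed (use that in auto)
    then show ?thesis by simp
  qed
  show "\<bar>g s - g t\<bar> \<le> \<bar>\<psi>' (r\<^sup>2)\<bar> * \<bar>s - t\<bar>" for s t
  proof -
    have "\<bar>clamp s - clamp t\<bar> \<le> \<bar>s - t\<bar>" by (simp add: clamp_def max_def min_def)
    then have "\<bar>\<psi>' (r\<^sup>2)\<bar> * \<bar>clamp s - clamp t\<bar> \<le> \<bar>\<psi>' (r\<^sup>2)\<bar> * \<bar>s - t\<bar>"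
      by (intro mult_left_mono) auto
    with lip[OF clamp_bounds(1) clamp_bounds(1), of s t] show ?thesis
      unfolding g_def by linarith
  qed
  show "R\<^sup>2 \<le> s \<Longrightarrow> g s = 0" for s
    using r2_less_R2 by (simp add: g_def clamp_def \<psi>_R)
  show "sqrt s * g s \<le> 1" if s: "0 \<le> s" for s
  proof -
    consider "s \<le> r\<^sup>2" | "r\<^sup>2 < s" "s < R\<^sup>2" | "R\<^sup>2 \<le> s" by linarith
    then show ?thesis
    proof cases
      case 1
      then have "sqrt s \<le> r" using r by (simp add: real_le_lsqrt)
      then show ?thesis
        using 1 r r2_less_R2 by (simp add: g_def clamp_def max_absorb1 min_absorb2 \<psi>_r)
    next
      case 2
      obtain m where m: "DIM('a) = Suc m"
        using dim by (cases "DIM('a)") auto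
      define \<sigma> where "\<sigma> = sqrt s"
      have \<sigma>: "s = \<sigma>\<^sup>2" "0 < \<sigma>" "r \<le> \<sigma>"
        using s less_imp_le[OF 2(1)] less_le_trans[OF zero_less_power[OF r] less_imp_le[OF 2(1)]]
        by (auto simp: \<sigma>_def real_le_rsqrt)
      \<comment> \<open>The norm of the field at radius \<rho> in the shell. In this form it is
        visibly decreasing in \<rho>, so it is at most its value at r, which is 1.\<close>
      have dec: "\<rho> * \<psi> (\<rho>\<^sup>2) = lam / real DIM('a) * (R ^ DIM('a) / \<rho> ^ m - \<rho>)" if "0 < \<rho>" for \<rho>
      proof -
        have "\<rho> * (k * (A / (\<rho> * \<rho> ^ m) - 1)) = k * (A / \<rho> ^ m - \<rho>)" for k A
          using that by (simp add: field_simps)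
        then show ?thesis
          unfolding \<psi>_square[OF that] by (simp add: m)
      qed
      have "\<sigma> * \<psi> (\<sigma>\<^sup>2) \<le> r * \<psi> (r\<^sup>2)"
        unfolding dec[OF \<sigma>(2)] dec[OF r] using \<sigma> r R lam N_pos
        by (intro mult_left_mono diff_mono divide_left_mono power_mono mult_pos_pos zero_less_power) auto
      then show ?thesis
        using 2 r \<sigma> by (simp add: g_def clamp_def max_absorb2 min_absorb2 \<psi>_r)
    next
      case 3
      then show ?thesis
        using r2_less_R2 by (simp add: g_def clamp_def \<psi>_R)
    qed
  qed
  show "(g has_real_derivative g' s) (at s)" if s: "0 \<le> s" "s \<notin> {r\<^sup>2, R\<^sup>2}" for s
  proof -
    consider "s < r\<^sup>2" | "r\<^sup>2 < s" "s < R\<^sup>2" | "R\<^sup>2 < s" using s(2) by force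
    then show ?thesis
    proof cases
      case 1
      have "((\<lambda>_. \<psi> (r\<^sup>2)) has_real_derivative g' s) (at s)"
        using 1 by (auto simp: g'_def)
      then show ?thesis
        by (rule has_field_derivative_transform_within_open[where S = "{..<r\<^sup>2}"])
          (use 1 r2_less_R2 in \<open>auto simp: g_def clamp_def\<close>)
    next
      case 2
      have "0 < s" using 2(1) zero_le_power2[of r] by linarith
      then have "(\<psi> has_real_derivative g' s) (at s)"
        using deriv_\<psi> 2 by (simp add: g'_def)
      then show ?thesis
        by (rule has_field_derivative_transform_within_open[where S = "{r\<^sup>2<..<R\<^sup>2}"])
          (use 2 in \<open>auto simp: g_def clamp_def\<close>)
    next
      case 3
      have "((\<lambda>_. \<psi> (R\<^sup>2)) has_real_derivative g' s) (at s)"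
        using 3 by (auto simp: g'_def)
      then show ?thesis
        by (rule has_field_derivative_transform_within_open[where S = "{R\<^sup>2<..}"])
          (use 3 r2_less_R2 in \<open>auto simp: g_def clamp_def\<close>)
    qed
  qed
  show "g' \<in> borel_measurable borel"
    unfolding g'_def \<psi>'_def by measurable
qed simp_all

lemma mem_cball_iff: "0 < \<rho> \<Longrightarrow> x \<in> cball p \<rho> \<longleftrightarrow> (x - p) \<bullet> (x - p) \<le> \<rho>\<^sup>2"
  by (simp add: dist_norm norm_minus_commute[of p] power2_norm_eq_inner[symmetric] abs_le_square_iff[symmetric])

text \<open>In the shell N \<psi> + 2 s \<psi>' = - lam. As \<open>g'\<close> is 0 at both kinks,
  the formula holds at every point, with the inner ball closed and the outer one open.\<close>

lemma d_eq: "d x = (if x \<in> cball p r then real DIM('a) / r else if x \<in> ball p R then - lam else 0)"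
proof -
  define s where "s = (x - p) \<bullet> (x - p)"
  have ball: "x \<in> ball p R \<longleftrightarrow> s < R\<^sup>2"
    using power_mono_iff[of R "norm (x - p)" 2] R
    by (simp add: s_def dist_norm norm_minus_commute[of p] power2_norm_eq_inner[symmetric] flip: not_le)
  have d: "d x = real DIM('a) * g s + 2 * s * g' s"
    by (simp add: d_def s_def)
  show ?thesis
  proof (cases "s \<le> r\<^sup>2")
    case True
    then show ?thesis
      using d r r2_less_R2 unfolding mem_cball_iff[OF r] s_def[symmetric]
      by (simp add: g_def g'_def clamp_def \<psi>_r)
  next
    case out: False
    then have s: "0 < s" using zero_le_power2[of r] by linarith
    show ?thesis
    proof (cases "s < R\<^sup>2")
      case True
      have "s powr (- (real DIM('a) / 2)) = s * s powr (- (real DIM('a) / 2) - 1)"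
        using s by (simp add: powr_mult_base)
      then have "real DIM('a) * \<psi> s + 2 * s * \<psi>' s = - lam"
        using N_pos by (simp add: \<psi>_def \<psi>'_def field_simps)
      then show ?thesis
        using True out d unfolding mem_cball_iff[OF r] ball s_def[symmetric]
        by (simp add: g_def g'_def clamp_def)
    next
      case False
      then show ?thesis
        using out d r2_less_R2 unfolding mem_cball_iff[OF r] ball s_def[symmetric]
        by (simp add: g_def g'_def clamp_def \<psi>_R)
    qed
  qed
qed

section \<open>The solution carried by one ball\<close>

definition c :: real where
  "c = (real DIM('a) / r - lam) powr (1 / (q - 1))"

definition u :: "'a \<Rightarrow> real" where
  "u x = c * indicator (cball p r) x"

lemma c_powr: "c powr (q - 1) = real DIM('a) / r - lam"
proof -
  have "0 < real DIM('a) / r - lam"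
    using r_small powr_ge_zero[of a "q - 1"] by linarith
  then show ?thesis using q by (simp add: c_def powr_powr)
qed

lemma a_less_c: "a < c"
proof -
  have "(a powr (q - 1)) powr (1 / (q - 1)) < c"
    unfolding c_def using q r_small by (intro powr_less_mono2) auto
  then show ?thesis using q a by (simp add: powr_powr)
qed

lemma c_pos: "0 < c"
  using a a_less_c by simp

lemma G_kernel_c: "G_kernel q a c = real DIM('a) / r - lam"
  using c_pos a_less_c by (simp add: G_kernel_eq[OF q a] c_powr)

lemma open_\<Omega>: "open \<Omega>" and bounded_\<Omega>: "bounded \<Omega>"
  using smooth by (auto simp: smooth_bounded_domain_def)

lemma support_subset_\<Omega>: "cball p (sqrt (R\<^sup>2)) \<subseteq> \<Omega>"
  using subset R by simp

lemma cball_subset: "cball p r \<subseteq> \<Omega>"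
  using subset r_less_R by (meson less_imp_le order_trans subset_cball)

lemma integral_indicator_ball:
  "integrable (lebesgue_on \<Omega>) (\<lambda>x. k * indicat_real (cball p r) x)"
  "(\<integral>x. k * indicat_real (cball p r) x \<partial>lebesgue_on \<Omega>) = k * measure lebesgue (cball p r)"
proof -
  have eq: "indicat_real \<Omega> x *\<^sub>R (k * indicat_real (cball p r) x) = k * indicat_real (cball p r) x" for x
    using cball_subset by (auto simp: indicator_def)
  show "integrable (lebesgue_on \<Omega>) (\<lambda>x. k * indicat_real (cball p r) x)"
    using open_\<Omega> integrable_indicator_cball[of k p r]
    by (subst integrable_restrict_space) (simp, simp only: eq)
  show "(\<integral>x. k * indicat_real (cball p r) x \<partial>lebesgue_on \<Omega>) = k * measure lebesgue (cball p r)"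
    using open_\<Omega> by (subst integral_restrict_space) (simp, simp only: eq, simp)
qed

lemma u_measurable: "u \<in> borel_measurable (lebesgue_on \<Omega>)"
  unfolding u_def [abs_def] by (rule borel_measurable_integrable[OF integral_indicator_ball(1)])

lemma u_Lq: "u \<in> Lq \<Omega> q"
proof -
  have "(\<lambda>x. \<bar>u x\<bar> powr q) = (\<lambda>x. c powr q * indicat_real (cball p r) x)"
    using c_pos by (auto simp: u_def indicator_def)
  then show ?thesis
    using u_measurable integral_indicator_ball(1) by (simp add: Lq_def)
qed

lemma u_d: "(\<lambda>x. u x * d x) = (\<lambda>x. c * (real DIM('a) / r) * indicat_real (cball p r) x)"
  by (auto simp: u_def d_eq)

lemma u_integrable: "integrable (lebesgue_on \<Omega>) u"
  unfolding u_def [abs_def] by (rule integral_indicator_ball)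

text \<open>The perimeter bound from above and the calibration from below meet because
  \<open>y\<close> is the unit outer normal on the sphere of radius r.\<close>

lemma total_variation_u: "total_variation \<Omega> u = ereal (\<integral>x. u x * d x \<partial>lebesgue_on \<Omega>)"
proof (rule antisym)
  show "total_variation \<Omega> u \<le> ereal (\<integral>x. u x * d x \<partial>lebesgue_on \<Omega>)"
    using total_variation_ball_le[OF open_\<Omega> cball_subset r, of c] c_pos
    unfolding u_d integral_indicator_ball by (simp add: u_def [abs_def] mult.assoc)
  show "ereal (\<integral>x. u x * d x \<partial>lebesgue_on \<Omega>) \<le> total_variation \<Omega> u"
    by (rule integral_le_total_variation[OF open_\<Omega> support_subset_\<Omega> u_integrable])
qed

lemma BV_norm_u: "BV_norm \<Omega> u = ereal (\<integral>x. u x * d x \<partial>lebesgue_on \<Omega>)"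
  using BV_norm_eq_total_variation[OF smooth compact_cball cball_subset, of u]
  by (simp add: u_def total_variation_u)

lemma u_BV: "u \<in> BV \<Omega>"
  by (simp add: BV_def u_integrable total_variation_u)

lemma solution: "is_solution \<Omega> q lam a u"
  unfolding is_solution_def
proof (intro conjI u_BV exI)
  \<comment> \<open>The three regions of \<open>d_eq\<close>: lam + c^(q-1) = N / r on the ball, -
    lam in the shell, 0 beyond. Outside the ball u = 0, where both -1 and 0 lie in
    \<open>grad_F 0\<close>.\<close>
  let ?\<rho>1 = "\<lambda>x. if x \<in> cball p r then 1 else if x \<in> ball p R then - 1 else 0 :: real"
  let ?\<rho>2 = "\<lambda>x. if x \<in> cball p r then c powr (q - 1) else 0"
  show "(\<lambda>x. - y x) \<in> borel_measurable (lebesgue_on \<Omega>)"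
    using borel_measurable_continuous_onI[OF continuous_on_y]
    by (intro lebesgue_on_measurable[OF open_\<Omega> support_subset_\<Omega>]) simp
  show "AE x in lebesgue_on \<Omega>. norm (- y x) \<le> 1"
    using norm_y by simp
  show "has_weak_divergence \<Omega> (\<lambda>x. - y x) (\<lambda>x. - d x)"
    by (rule weak_divergence[OF open_\<Omega> support_subset_\<Omega>])
  show "integrable (lebesgue_on \<Omega>) (\<lambda>x. u x * - d x)"
    using integral_le_total_variation(1)[OF open_\<Omega> support_subset_\<Omega> u_integrable] by simp
  show "ereal (- (\<integral>x. u x * - d x \<partial>lebesgue_on \<Omega>)) = BV_norm \<Omega> u"
    by (simp add: BV_norm_u)
  show "?\<rho>1 \<in> borel_measurable (lebesgue_on \<Omega>)" "?\<rho>2 \<in> borel_measurable (lebesgue_on \<Omega>)"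
    by (intro lebesgue_on_measurable[OF open_\<Omega> support_subset_\<Omega>] measurable_If_set measurable_const; simp)+
  show "AE x in lebesgue_on \<Omega>. - (- d x) = lam * ?\<rho>1 x + ?\<rho>2 x"
    by (intro always_eventually) (auto simp: d_eq c_powr)
  show "AE x in lebesgue_on \<Omega>. ?\<rho>1 x \<in> grad_F (u x)"
    using c_pos by (intro always_eventually) (auto simp: u_def grad_F_def)
  have "\<bar>c\<bar> powr (q - 2) * c = c powr (q - 1)"
    using G_kernel_c a_less_c c_pos by (simp add: G_kernel_def heaviside_def c_powr)
  then show "AE x in lebesgue_on \<Omega>. ?\<rho>2 x \<in> grad_G q a (u x)"
    using c_pos a_less_c a by (intro always_eventually) (auto simp: u_def grad_G_def)
qed

text \<open>With U and V the integrals of u d and v d, the Clarke derivative is at least U - V,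
  while \<open>\<Psi>\<close> is at least V at v and equals U at u; the three add up to at least
  0.\<close>

lemma critical: "is_critical_point \<Omega> q lam a u"
  unfolding is_critical_point_def critical_point_def
proof (intro conjI u_Lq ballI)
  have \<Psi>_u: "\<Psi> \<Omega> u = ereal (\<integral>x. u x * d x \<partial>lebesgue_on \<Omega>)"
    by (simp add: \<Psi>_def u_BV BV_norm_u)
  show "ereal (\<Phi> \<Omega> q lam a u) + \<Psi> \<Omega> u < \<infinity>"
    by (simp add: \<Psi>_u)
  fix v assume v: "v \<in> Lq \<Omega> q"
  let ?h = "\<lambda>x. v x - u x"
  let ?U = "\<integral>x. u x * d x \<partial>lebesgue_on \<Omega>" and ?V = "\<integral>x. v x * d x \<partial>lebesgue_on \<Omega>"
  have h: "?h \<in> Lq \<Omega> q"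
    using Lq_lincomb[OF q a v u_Lq, of "- 1"] by simp
  have v_int: "integrable (lebesgue_on \<Omega>) v"
    by (rule Lq_integrable[OF q a bounded_\<Omega> open_\<Omega> v])
  note vd = integral_le_total_variation[OF open_\<Omega> support_subset_\<Omega> v_int]
  note ud = integral_le_total_variation[OF open_\<Omega> support_subset_\<Omega> u_integrable]
  have dh: "(\<lambda>x. d x * ?h x) = (\<lambda>x. v x * d x - u x * d x)"
    by (auto simp: algebra_simps)
  have "ereal (- (\<integral>x. d x * ?h x \<partial>lebesgue_on \<Omega>)) \<le>
      clarke_derivative (Lq \<Omega> q) (Lq_norm \<Omega> q) (\<Phi> \<Omega> q lam a) u ?h"
  proof (rule clarke_derivative_\<Phi>_ge[OF q a bounded_\<Omega> open_\<Omega> u_Lq h lam])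
    show "integrable (lebesgue_on \<Omega>) (\<lambda>x. d x * ?h x)"
      unfolding dh by (intro Bochner_Integration.integrable_diff vd(1) ud(1))
    show "AE x in lebesgue_on \<Omega>. u x \<noteq> 0 \<longrightarrow> d x = lam * sgn (u x) + G_kernel q a (u x)"
      using c_pos G_kernel_c by (intro always_eventually) (auto simp: u_def d_eq indicator_def)
    show "AE x in lebesgue_on \<Omega>. u x = 0 \<longrightarrow> \<bar>d x\<bar> \<le> lam"
      using c_pos lam by (intro always_eventually) (auto simp: u_def d_eq indicator_def)
  qed
  then have 1: "ereal (?U - ?V) \<le> clarke_derivative (Lq \<Omega> q) (Lq_norm \<Omega> q) (\<Phi> \<Omega> q lam a) u ?h"
    using vd(1) ud(1) by (simp add: dh)
  \<comment> \<open>Trivial for v outside \<open>BV \<Omega>\<close>. Since both lower bounds are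
    finite, the extended sum below never involves minus infinity.\<close>
  have 2: "ereal ?V \<le> \<Psi> \<Omega> v"
    using order_trans[OF vd(2) total_variation_le_BV_norm] by (simp add: \<Psi>_def)
  have "ereal ?U \<le> clarke_derivative (Lq \<Omega> q) (Lq_norm \<Omega> q) (\<Phi> \<Omega> q lam a) u ?h + \<Psi> \<Omega> v"
    using add_mono[OF 1 2] by simp
  from ereal_minus_mono[OF this order_refl[of "\<Psi> \<Omega> u"]]
  show "0 \<le> clarke_derivative (Lq \<Omega> q) (Lq_norm \<Omega> q) (\<Phi> \<Omega> q lam a) u ?h + \<Psi> \<Omega> v - \<Psi> \<Omega> u"
    by (simp add: \<Psi>_u flip: zero_ereal_def)
qed

lemma measure_superlevel_pos: "0 < measure lebesgue {x \<in> \<Omega>. a < \<bar>u x\<bar>}"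
proof -
  have "{x \<in> \<Omega>. a < \<bar>u x\<bar>} = cball p r"
    using cball_subset a a_less_c by (auto simp: u_def indicator_def)
  then show ?thesis
    using r by (simp add: content_cball)
qed

end

section \<open>The family of small balls\<close>

definition ball_function :: "'a::euclidean_space \<Rightarrow> real \<Rightarrow> real \<Rightarrow> real \<Rightarrow> 'a \<Rightarrow> real" where
  "ball_function p q lam r x =
     (real DIM('a) / r - lam) powr (1 / (q - 1)) * indicator (cball p r) x"

text \<open>R is the N-th root dictated by the flux balance. For r < 1 and N \<ge> 2 both powers of
  r in it are at most r, so R^N \<le> r (1 + N / lam) < \<rho>^N and the field fits into \<Omega>.
  The last condition on r is \<open>r_small\<close> multiplied out.\<close>

lemma small_ball_solution:
  fixes \<Omega> :: "'a::euclidean_space set"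
  assumes dim: "2 \<le> DIM('a)" and smooth: "smooth_bounded_domain \<Omega>" and q: "1 < q"
    and a: "0 < a" and lam: "0 < lam" and \<rho>: "0 < \<rho>" "cball p \<rho> \<subseteq> \<Omega>"
    and r: "0 < r" "r < 1" "r * (1 + real DIM('a) / lam) < \<rho> ^ DIM('a)"
      "r * (lam + a powr (q - 1)) < real DIM('a)"
  shows "is_critical_point \<Omega> q lam a (ball_function p q lam r)"
    and "is_solution \<Omega> q lam a (ball_function p q lam r)"
    and "0 < measure lebesgue {x \<in> \<Omega>. a < \<bar>ball_function p q lam r x\<bar>}"
proof -
  let ?n = "DIM('a)"
  define X where "X = r ^ ?n + real ?n * r ^ (?n - 1) / lam"
  define R where "R = root ?n X"
  have X: "0 < X" using r(1) lam by (simp add: X_def add_pos_nonneg)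
  have R: "0 < R" "R ^ ?n = X"
    using X dim by (auto simp: R_def real_root_pow_pos2)
  have "r ^ ?n \<le> r ^ 1" "r ^ (?n - 1) \<le> r ^ 1"
    using r dim by (intro power_decreasing; simp)+
  then have "X \<le> r + real ?n * r / lam"
    using lam by (auto simp: X_def intro!: add_mono divide_right_mono mult_left_mono)
  also have "\<dots> < \<rho> ^ ?n"
    using r(3) by (simp add: algebra_simps)
  finally have "R < \<rho>"
    unfolding R(2)[symmetric] using \<rho>(1) by (simp add: power_less_imp_less_base)
  then have sub: "cball p R \<subseteq> \<Omega>"
    using \<rho>(2) by (meson less_imp_le order_trans subset_cball)
  interpret ball_solution \<Omega> p r R lam q a
    by unfold_locales
      (use assms R X_def sub in \<open>auto simp: field_simps\<close>)
  have "ball_function p q lam r = u"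
    by (rule ext) (simp add: ball_function_def u_def c_def)
  then show "is_critical_point \<Omega> q lam a (ball_function p q lam r)"
    and "is_solution \<Omega> q lam a (ball_function p q lam r)"
    and "0 < measure lebesgue {x \<in> \<Omega>. a < \<bar>ball_function p q lam r x\<bar>}"
    using critical solution measure_superlevel_pos by simp_all
qed

text \<open>On the open annulus between the radii the function of the smaller ball is 0 and the
  other one is positive; a nonempty open set is not negligible.\<close>

lemma ball_function_not_ae_eq:
  fixes \<Omega> :: "'a::euclidean_space set"
  assumes \<Omega>: "open \<Omega>" "ball p r \<subseteq> \<Omega>" and r: "0 < s" "s < r" and c: "lam < real DIM('a) / r"
  shows "(ball_function p q lam r, ball_function p q lam s) \<notin> ae_eq \<Omega>"
proof
  assume "(ball_function p q lam r, ball_function p q lam s) \<in> ae_eq \<Omega>"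
  then have ae: "AE x in lebesgue. x \<in> \<Omega> \<longrightarrow> ball_function p q lam r x = ball_function p q lam s x"
    using \<Omega>(1) by (simp add: ae_eq_def AE_restrict_space_iff)
  let ?A = "ball p r - cball p s"
  have "AE x in lebesgue. x \<notin> ?A"
    using ae
  proof eventually_elim
    case (elim x)
    show ?case
    proof
      assume x: "x \<in> ?A"
      then have "x \<notin> cball p s" "x \<in> cball p r" "x \<in> \<Omega>"
        using \<Omega>(2) by auto
      then show False using elim c by (simp add: ball_function_def indicator_def)
    qed
  qed
  moreover have A: "open ?A" by (intro open_Diff) auto
  ultimately have "negligible ?A"
    using AE_iff_null_sets[of ?A lebesgue] by (simp add: negligible_iff_null_sets del: Diff_iff)
  moreover note A
  ultimately have "?A = {}" using open_not_negligible by blast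
  moreover obtain e :: 'a where e: "e \<in> Basis" using nonempty_Basis by blast
  have "p + ((r + s) / 2) *\<^sub>R e \<in> ?A"
    using r e by (simp add: dist_norm)
  ultimately show False by blast
qed

lemma ae_eq_sym: "(u, v) \<in> ae_eq \<Omega> \<Longrightarrow> (v, u) \<in> ae_eq \<Omega>"
  by (auto simp: ae_eq_def elim: eventually_mono)

lemma infinite_quotient_ae_eq:
  assumes "\<And>n::nat. f n \<in> A" and "\<And>m n. m \<noteq> n \<Longrightarrow> (f m, f n) \<notin> ae_eq \<Omega>"
  shows "infinite (A // ae_eq \<Omega>)"
proof -
  have "inj (\<lambda>n. ae_eq \<Omega> `` {f n})"
  proof (rule injI, rule ccontr)
    fix m n assume eq: "ae_eq \<Omega> `` {f m} = ae_eq \<Omega> `` {f n}" and "m \<noteq> n"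
    have "f n \<in> ae_eq \<Omega> `` {f n}" by (simp add: ae_eq_def)
    then show False using assms(2)[OF \<open>m \<noteq> n\<close>] eq by blast
  qed
  then have "infinite (range (\<lambda>n. ae_eq \<Omega> `` {f n}))"
    by (rule range_inj_infinite)
  then show ?thesis
    by (rule infinite_super[rotated]) (auto intro: quotientI assms(1))
qed

theorem theorem1p1:
  fixes \<Omega> :: "(real ^ 'n) set" and q :: real
  assumes "CARD('n) \<ge> 2"
    and "smooth_bounded_domain \<Omega>"
    and "1 < q" and "q < real CARD('n) / (real CARD('n) - 1)"
  shows "\<exists>lam0>0. \<exists>u :: real \<Rightarrow> real \<Rightarrow> nat \<Rightarrow> real ^ 'n \<Rightarrow> real.
    \<forall>lam. 0 < lam \<and> lam < lam0 \<longrightarrow>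
      (\<forall>a>0.
         (\<forall>n. is_critical_point \<Omega> q lam a (u lam a n) \<and> is_solution \<Omega> q lam a (u lam a n)) \<and>
         (\<forall>m n. m \<noteq> n \<longrightarrow> (u lam a m, u lam a n) \<notin> ae_eq \<Omega>) \<and>
         infinite ({v. is_solution \<Omega> q lam a v} // ae_eq \<Omega>)) \<and>
      (\<exists>a0>0. \<forall>a. 0 < a \<and> a < a0 \<longrightarrow>
         (\<forall>n. measure lebesgue {x \<in> \<Omega>. \<bar>u lam a n x\<bar> > a} > 0))"
proof -
  have dim: "2 \<le> DIM(real ^ 'n)" using assms(1) by simp
  have \<Omega>: "open \<Omega>" "\<Omega> \<noteq> {}" using assms(2) by (auto simp: smooth_bounded_domain_def)
  then obtain p \<rho> where \<rho>: "0 < \<rho>" "cball p \<rho> \<subseteq> \<Omega>"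
    by (metis all_not_in_conv open_contains_cball)
  define N where "N = real DIM(real ^ 'n)"
  have N: "0 < N" using dim by (simp add: N_def)
  \<comment> \<open>The sum of all lower thresholds for 1 / r: 1 for r < 1, 1 / \<rho> for the ball
    to lie in \<Omega>, and the last two for the remaining conditions of
    \<open>small_ball_solution\<close>. All summands are positive, so M exceeds each of them. Adding
    n keeps the thresholds and makes the radii 1 / (M + n) distinct.\<close>
  define M where "M = (\<lambda>lam a. 1 + 1 / \<rho> + (1 + N / lam) / \<rho> ^ DIM(real ^ 'n) + (lam + a powr (q - 1)) / N)"
  define r where "r = (\<lambda>lam a (n::nat). 1 / (M lam a + real n))"
  define u where "u = (\<lambda>lam a n. ball_function p q lam (r lam a n))"
  have M_ge: "1 < M lam a" "1 / \<rho> < M lam a" "(1 + N / lam) / \<rho> ^ DIM(real ^ 'n) < M lam a" "(lam + a powr (q - 1)) / N < M lam a"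
    if "0 < lam" for lam a
  proof -
    have "0 < (1 + N / lam) / \<rho> ^ DIM(real ^ 'n)" "0 < (lam + a powr (q - 1)) / N"
      using that N \<rho>(1) by (auto intro!: divide_pos_pos add_pos_nonneg)
    moreover have "0 < 1 / \<rho>" using \<rho>(1) by simp
    ultimately show "1 < M lam a" "1 / \<rho> < M lam a" "(1 + N / lam) / \<rho> ^ DIM(real ^ 'n) < M lam a" "(lam + a powr (q - 1)) / N < M lam a"
      unfolding M_def by linarith+
  qed
  have r: "0 < r lam a n" "r lam a n < 1" "r lam a n * (1 + N / lam) < \<rho> ^ DIM(real ^ 'n)"
    "r lam a n * (lam + a powr (q - 1)) < N" if lam: "0 < lam" for lam a n
  proof -
    define k where "k = M lam a + real n"
    have k: "1 < k" "(1 + N / lam) / \<rho> ^ DIM(real ^ 'n) < k" "(lam + a powr (q - 1)) / N < k"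
      using M_ge[OF lam, of a] by (auto simp: k_def intro: less_le_trans)
    have rk: "r lam a n = 1 / k" by (simp add: r_def k_def)
    show "0 < r lam a n" "r lam a n < 1" using k(1) by (auto simp: rk)
    show "r lam a n * (1 + N / lam) < \<rho> ^ DIM(real ^ 'n)"
      using k(1,2) \<rho>(1) unfolding rk by (simp add: pos_divide_less_eq mult.commute)
    show "r lam a n * (lam + a powr (q - 1)) < N"
      using k(1,3) N unfolding rk by (simp add: pos_divide_less_eq mult.commute)
  qed
  have sol': "is_critical_point \<Omega> q lam a (u lam a n)" "is_solution \<Omega> q lam a (u lam a n)"
    "0 < measure lebesgue {x \<in> \<Omega>. a < \<bar>u lam a n x\<bar>}" if "0 < lam" "0 < a" for lam a n
    unfolding u_def
    using small_ball_solution[OF dim assms(2,3) that(2,1) \<rho>] r[OF that(1), of a n] unfolding N_def by blast+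
  have lt: "(u lam a m, u lam a n) \<notin> ae_eq \<Omega>" if "0 < lam" "0 < a" "m < n" for lam a m n
    unfolding u_def
  proof (rule ball_function_not_ae_eq[OF \<Omega>(1) _ r(1)[OF that(1)]])
    show "r lam a n < r lam a m"
      using that(3) M_ge(1)[OF that(1), of a] by (simp add: r_def frac_less2)
    have rm: "0 < r lam a m" by (rule r(1)[OF that(1)])
    show "lam < real DIM(real ^ 'n) / r lam a m"
    proof -
      have "r lam a m * lam \<le> r lam a m * (lam + a powr (q - 1))"
        using rm by (intro mult_left_mono) auto
      also have "\<dots> < N" by (rule r(4)[OF that(1)])
      finally show ?thesis using rm by (simp add: N_def field_simps)
    qed
    have "1 / \<rho> < M lam a + real m" "0 < M lam a + real m"
      using M_ge(1,2)[OF that(1), of a] by linarith+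
    then have "r lam a m < \<rho>"
      using \<rho>(1) by (simp add: r_def field_simps)
    then show "ball p (r lam a m) \<subseteq> \<Omega>"
      using \<rho>(2) by auto
  qed
  have neq: "(u lam a m, u lam a n) \<notin> ae_eq \<Omega>" if "0 < lam" "0 < a" "m \<noteq> n" for lam a m n
    using lt[OF that(1,2), of m n] lt[OF that(1,2), of n m] ae_eq_sym[of "u lam a m" "u lam a n" \<Omega>] that(3)
    by (meson linorder_neqE_nat)
  show ?thesis
  \<comment> \<open>The radii adapt to \<open>lam\<close> and \<open>a\<close>, so both thresholds
    \<open>lam0\<close> and \<open>a0\<close> can be taken to be 1.\<close>
  proof (rule exI[of _ 1], intro conjI exI[of _ u] allI impI)
    fix lam a :: real and n assume "0 < lam \<and> lam < 1" "0 < a"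
    then show "is_critical_point \<Omega> q lam a (u lam a n)" "is_solution \<Omega> q lam a (u lam a n)"
      using sol' by auto
  next
    fix lam a :: real and m n :: nat assume "0 < lam \<and> lam < 1" "0 < a" "m \<noteq> n"
    then show "(u lam a m, u lam a n) \<notin> ae_eq \<Omega>" using neq by blast
  next
    fix lam a :: real assume "0 < lam \<and> lam < 1" "0 < a"
    then show "infinite ({v. is_solution \<Omega> q lam a v} // ae_eq \<Omega>)"
      using sol'(2) neq by (intro infinite_quotient_ae_eq[of "u lam a"]) auto
  next
    fix lam :: real assume "0 < lam \<and> lam < 1"
    then show "\<exists>a0>0. \<forall>a. 0 < a \<and> a < a0 \<longrightarrow> (\<forall>n. 0 < measure lebesgue {x \<in> \<Omega>. a < \<bar>u lam a n x\<bar>})"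
      using sol'(3) by (intro exI[of _ 1]) auto
  qed simp
qed

end
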